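(* Let $\rho\in[1,2)$, $\delta\in(0,1]$ and $X_\delta=\omega_\delta-\omega$. The area $$\mathbb{X}_\delta(s,t):=\int_s^t(X_\delta(r)-X_\delta(s))\otimes dX_\delta(r)$$ is well-defined for all $0\le s\le t$. In particular, for all $1\le i,j\le m$ and $0\le s\le t$, $$|\mathbb{X}_\delta^{i,j}(s,t)|_{L_2}^2\le C\,\delta^{2(1-1/\rho)}M^2|t-s|^{2/\rho},\qquad M:=\Big(\frac{2^{1+\rho}+1}{3^{1-\rho}}\Big)^{1/\rho},$$ where $C$ depends only on $\rho$.
   Context: $\omega$ is the canonical two-sided Brownian motion in $\mathbb{R}^m$ (independent components, $\omega(0)=0$), and for $\delta\in(0,1]$, $\omega_\delta(t)=\frac1\delta\int_0^t(\omega(\delta+r)-\omega(r))\,dr$, $t\in\mathbb{R}$. Meaning of the area: for $i<j$, $\mathbb{X}_\delta^{i,j}(s,t)=\int_s^t(X_\delta^i(r)-X_\delta^i(s))\,dX_\delta^j(r)$ is the $L_2$-limit of the Riemann sums $\sum_{[u,v]\in\mathcal{P}}(X_\delta^i(u)-X_\delta^i(s))(X_\delta^j(v)-X_\delta^j(u))$ over partitions $\mathcal{P}$ of $[s,t]$ as the mesh $|\mathcal{P}|\to0$ (well-definedness means that this limit exists); furthermore $\mathbb{X}_\delta^{i,i}(s,t)=\frac12(X_\delta^i(t)-X_\delta^i(s))^2$ and $\mathbb{X}_\delta^{j,i}(s,t)=-\mathbb{X}_\delta^{i,j}(s,t)+(X_\delta^i(t)-X_\delta^i(s))(X_\delta^j(t)-X_\delta^j(s))$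 for $i<j$. $|\cdot|_{L_2}$ is the $L_2(\Omega)$-norm. *)

theory Defs
  imports "HOL-Probability.Probability"
begin

text \<open>
  A vector of R^m is an extensional function on the index set {1..m}. The dimension is thus an
  ordinary variable, and a constant can be asserted to be independent of it.
\<close>

type_synonym path = "real \<Rightarrow> nat \<Rightarrow> real"

definition wiener_paths :: "nat \<Rightarrow> path set" where
  "wiener_paths m =
     {w. (\<forall>t. w t \<in> {1..m} \<rightarrow>\<^sub>E UNIV) \<and>
         (\<forall>i\<in>{1..m}. continuous_on UNIV (\<lambda>t. w t i) \<and> w 0 i = 0)}"

text \<open>
  The trace of the product sigma-algebra on the path space is its Borel sigma-algebra for locally
  uniform convergence.
\<close>

definition wiener_space :: "nat \<Rightarrow> path measure" where
  "wiener_space m =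
     restrict_space (\<Pi>\<^sub>M t\<in>UNIV. \<Pi>\<^sub>M i\<in>{1..m}. borel) (wiener_paths m)"

text \<open>
  Since the time points range over the whole real line, independence of the increments together
  with \<open>B 0 = 0\<close> makes the two halves of the process independent one-sided Brownian motions.
\<close>

definition two_sided_brownian_motion :: "'a measure \<Rightarrow> ('a \<Rightarrow> real \<Rightarrow> real) \<Rightarrow> bool" where
  "two_sided_brownian_motion P B \<longleftrightarrow>
     (\<forall>x\<in>space P. B x 0 = 0 \<and> continuous_on UNIV (B x)) \<and>
     (\<forall>s t. s < t \<longrightarrow>
        distributed P lborel (\<lambda>x. B x t - B x s) (\<lambda>y. ennreal (normal_density 0 (sqrt (t - s)) y))) \<and>
     (\<forall>n (\<tau> :: nat \<Rightarrow> real). strict_mono_on {..n} \<tau> \<longrightarrow>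
        prob_space.indep_vars P (\<lambda>_. borel) (\<lambda>k x. B x (\<tau> (Suc k)) - B x (\<tau> k)) {..<n})"

text \<open>
  \<open>P\<close> is the law on path space under which the coordinate process is an \<open>m\<close>-dimensional two-sided
  Brownian motion.
\<close>

definition wiener_measure :: "nat \<Rightarrow> path measure \<Rightarrow> bool" where
  "wiener_measure m P \<longleftrightarrow>
     prob_space P \<and> sets P = sets (wiener_space m) \<and>
     (\<forall>i\<in>{1..m}. two_sided_brownian_motion P (\<lambda>w t. w t i)) \<and>
     prob_space.indep_vars P (\<lambda>_. \<Pi>\<^sub>M t\<in>UNIV. borel) (\<lambda>i w t. w t i) {1..m}"

text \<open>The interval integral is oriented, as required for \<open>t < 0\<close>.\<close>

definition smoothed :: "real \<Rightarrow> path \<Rightarrow> path" where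
  "smoothed \<delta> w t i = (1 / \<delta>) * (LBINT r=ereal 0..ereal t. w (\<delta> + r) i - w r i)"

definition smoothing_error :: "real \<Rightarrow> path \<Rightarrow> path" where
  "smoothing_error \<delta> w t i = smoothed \<delta> w t i - w t i"

definition square_integrable :: "'a measure \<Rightarrow> ('a \<Rightarrow> real) \<Rightarrow> bool" where
  "square_integrable P f \<longleftrightarrow> f \<in> borel_measurable P \<and> integrable P (\<lambda>x. (f x)\<^sup>2)"

text \<open>Only meaningful for square integrable \<open>f\<close>: a divergent Bochner integral is 0.\<close>

definition L2_norm :: "'a measure \<Rightarrow> ('a \<Rightarrow> real) \<Rightarrow> real" where
  "L2_norm P f = sqrt (\<integral>x. (f x)\<^sup>2 \<partial>P)"

text \<open>
  The elements of \<open>p\<close> are compact intervals \<open>[u, v]\<close> with \<open>u = Inf K\<close> and \<open>v = Sup K\<close>;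
  degenerate ones contribute 0.
\<close>

definition riemann_sum ::
    "('a \<Rightarrow> path) \<Rightarrow> nat \<Rightarrow> nat \<Rightarrow> real \<Rightarrow> real set set \<Rightarrow> 'a \<Rightarrow> real" where
  "riemann_sum X i j s p x =
     (\<Sum>K\<in>p. (X x (Inf K) i - X x s i) * (X x (Sup K) j - X x (Inf K) j))"

definition has_L2_integral ::
    "'a measure \<Rightarrow> ('a \<Rightarrow> path) \<Rightarrow> nat \<Rightarrow> nat \<Rightarrow> real \<Rightarrow> real \<Rightarrow> ('a \<Rightarrow> real) \<Rightarrow> bool" where
  "has_L2_integral P X i j s t A \<longleftrightarrow>
     square_integrable P A \<and>
     (\<forall>\<epsilon>>0. \<exists>\<eta>>0. \<forall>p. p division_of {s..t} \<and> (\<forall>K\<in>p. Sup K - Inf K < \<eta>) \<longrightarrow>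
        square_integrable P (riemann_sum X i j s p) \<and>
        L2_norm P (\<lambda>x. riemann_sum X i j s p x - A x) < \<epsilon>)"

definition area_well_defined ::
    "'a measure \<Rightarrow> nat \<Rightarrow> ('a \<Rightarrow> path) \<Rightarrow> real \<Rightarrow> real \<Rightarrow> bool" where
  "area_well_defined P m X s t \<longleftrightarrow>
     (\<forall>i\<in>{1..m}. \<forall>j\<in>{1..m}. i < j \<longrightarrow> (\<exists>A. has_L2_integral P X i j s t A))"

text \<open>The \<open>L2\<close>-limit is unique up to null sets; \<open>SOME\<close> picks a version of it.\<close>

definition L2_integral ::
    "'a measure \<Rightarrow> ('a \<Rightarrow> path) \<Rightarrow> nat \<Rightarrow> nat \<Rightarrow> real \<Rightarrow> real \<Rightarrow> 'a \<Rightarrow> real" where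
  "L2_integral P X i j s t = (SOME A. has_L2_integral P X i j s t A)"

definition area ::
    "'a measure \<Rightarrow> ('a \<Rightarrow> path) \<Rightarrow> nat \<Rightarrow> nat \<Rightarrow> real \<Rightarrow> real \<Rightarrow> 'a \<Rightarrow> real" where
  "area P X i j s t x =
     (if i < j then L2_integral P X i j s t x
      else if i = j then (1 / 2) * (X x t i - X x s i)\<^sup>2
      else - L2_integral P X j i s t x + (X x t j - X x s j) * (X x t i - X x s i))"

end

theory Submission
  imports Defs
begin

text \<open>
  Up to a constant in time, \<open>X = \<omega>\<^sub>\<delta> - \<omega>\<close> is a moving average over \<open>[t, t + \<delta>]\<close> of increments of \<open>\<omega>\<close>
  starting in \<open>t\<close>. Hence the increments of \<open>X\<close> over \<open>[a, b]\<close> have variance of order \<open>min (b - a) \<delta>\<close>. For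
  independent components, integrate a step process \<open>\<Phi>\<close> depending on \<open>X\<^sup>i\<close> against
  \<open>dX\<^sup>j = \<delta>\<^sup>-\<^sup>1 (\<omega>\<^sup>j(r + \<delta>) - \<omega>\<^sup>j(r)) dr - d\<omega>\<^sup>j\<close>. Since the covariance of \<open>dX\<^sup>j\<close> is a signed measure whose
  total variation on \<open>[s, t]\<^sup>2\<close> is of order \<open>t - s\<close>, the integral has second moment at most a constant
  times \<open>t - s\<close> times the supremum over \<open>a\<close> of the second moment of \<open>\<Phi>(a)\<close>. Applied to the difference of two
  Riemann sums of mesh below \<open>\<eta>\<close>, where \<open>\<Phi>(a)\<close> is an increment of \<open>X\<^sup>i\<close> between two points at distance
  below \<open>\<eta>\<close>, this gives the Cauchy property; applied to a single sum, it bounds the area by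
  \<open>min (t - s) \<delta> * (t - s)\<close>, which interpolates to the asserted power of \<open>\<delta>\<close> and \<open>t - s\<close>. The diagonal
  terms need the fourth moment of the increments.
\<close>

subsection \<open>Square integrable functions\<close>

lemma abs_mult_le_sum_squares: "\<bar>a * b\<bar> \<le> a\<^sup>2 + b\<^sup>2" for a b :: real
proof -
  have "0 \<le> (\<bar>a\<bar> - \<bar>b\<bar>)\<^sup>2" by simp
  also have "\<dots> = a\<^sup>2 + b\<^sup>2 - 2 * \<bar>a * b\<bar>"
    by (simp add: power2_diff abs_mult)
  finally show ?thesis
    using abs_ge_zero[of "a * b"] by linarith
qed

lemma square_integrable_mult_integrable:
  assumes "square_integrable M f" and "square_integrable M g"
  shows "integrable M (\<lambda>x. f x * g x)"
proof (rule Bochner_Integration.integrable_bound)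
  show "integrable M (\<lambda>x. (f x)\<^sup>2 + (g x)\<^sup>2)"
    using assms by (auto simp: square_integrable_def)
  show "(\<lambda>x. f x * g x) \<in> borel_measurable M"
    using assms by (auto simp: square_integrable_def)
  show "AE x in M. norm (f x * g x) \<le> norm ((f x)\<^sup>2 + (g x)\<^sup>2)"
    using abs_mult_le_sum_squares by auto
qed

lemma square_integrable_cmult:
  assumes "square_integrable M f"
  shows "square_integrable M (\<lambda>x. c * f x)"
  using assms by (auto simp: square_integrable_def power_mult_distrib)

lemma square_integrable_add:
  assumes "square_integrable M f" and "square_integrable M g"
  shows "square_integrable M (\<lambda>x. f x + g x)"
proof -
  have "integrable M (\<lambda>x. (f x)\<^sup>2 + (g x)\<^sup>2 + 2 * (f x * g x))"
    using assms square_integrable_mult_integrable[OF assms]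
    by (intro Bochner_Integration.integrable_add) (auto simp: square_integrable_def)
  then show ?thesis
    using assms by (auto simp: square_integrable_def power2_sum algebra_simps)
qed

lemma square_integrable_diff:
  assumes "square_integrable M f" and "square_integrable M g"
  shows "square_integrable M (\<lambda>x. f x - g x)"
  using square_integrable_add[OF assms(1) square_integrable_cmult[OF assms(2), of "-1"]] by simp

lemma square_integrable_zero: "square_integrable M (\<lambda>x. 0)"
  by (simp add: square_integrable_def)

lemma square_integrable_sum:
  assumes "\<And>i. i \<in> I \<Longrightarrow> square_integrable M (f i)"
  shows "square_integrable M (\<lambda>x. \<Sum>i\<in>I. f i x)"
  using assms
  by (induction I rule: infinite_finite_induct)
     (auto intro: square_integrable_add square_integrable_zero)

lemma square_integrable_cong:
  assumes "\<And>x. x \<in> space M \<Longrightarrow> f x = g x"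
  shows "square_integrable M f \<longleftrightarrow> square_integrable M g"
proof -
  have "f \<in> borel_measurable M \<longleftrightarrow> g \<in> borel_measurable M"
    using assms by (rule measurable_cong)
  moreover have "integrable M (\<lambda>x. (f x)\<^sup>2) \<longleftrightarrow> integrable M (\<lambda>x. (g x)\<^sup>2)"
    using assms by (intro Bochner_Integration.integrable_cong) auto
  ultimately show ?thesis by (simp add: square_integrable_def)
qed

text \<open>Constants are square integrable on a finite measure space, so \<open>1 * (f x)^2\<close>
  is a product of two square integrable functions.\<close>

lemma square_integrable_if_square:
  assumes "finite_measure M" and [measurable]: "f \<in> borel_measurable M"
    and "square_integrable M (\<lambda>x. (f x)\<^sup>2)"
  shows "square_integrable M f"
proof -
  interpret finite_measure M by fact
  have "integrable M (\<lambda>x. 1 * (f x)\<^sup>2)"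
    using assms(3) by (intro square_integrable_mult_integrable) (auto simp: square_integrable_def)
  then show ?thesis by (simp add: square_integrable_def)
qed

lemma integral_square_add_le:
  assumes "square_integrable M f" and "square_integrable M g"
  shows "(\<integral>x. (f x + g x)\<^sup>2 \<partial>M) \<le> 2 * (\<integral>x. (f x)\<^sup>2 \<partial>M) + 2 * (\<integral>x. (g x)\<^sup>2 \<partial>M)"
proof -
  have int: "integrable M (\<lambda>x. (f x)\<^sup>2)" "integrable M (\<lambda>x. (g x)\<^sup>2)"
    "integrable M (\<lambda>x. (f x + g x)\<^sup>2)"
    using assms square_integrable_add[OF assms] by (auto simp: square_integrable_def)
  have "(\<integral>x. (f x + g x)\<^sup>2 \<partial>M) \<le> (\<integral>x. 2 * (f x)\<^sup>2 + 2 * (g x)\<^sup>2 \<partial>M)"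
  proof (rule integral_mono)
    fix x
    have "0 \<le> (f x - g x)\<^sup>2" by simp
    then show "(f x + g x)\<^sup>2 \<le> 2 * (f x)\<^sup>2 + 2 * (g x)\<^sup>2"
      by (simp add: power2_sum power2_diff)
  qed (use int in auto)
  also have "\<dots> = 2 * (\<integral>x. (f x)\<^sup>2 \<partial>M) + 2 * (\<integral>x. (g x)\<^sup>2 \<partial>M)"
    using int by simp
  finally show ?thesis .
qed

text \<open>Moment bounds are first derived with the nonnegative integral, where no integrability
  has to be known; this converts them into statements about the Bochner integral.\<close>

lemma square_integrable_if_nn_integral_le:
  assumes [measurable]: "f \<in> borel_measurable M"
    and le: "(\<integral>\<^sup>+x. ennreal ((f x)\<^sup>2) \<partial>M) \<le> ennreal c" and "0 \<le> c"
  shows "square_integrable M f" and "(\<integral>x. (f x)\<^sup>2 \<partial>M) \<le> c"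
proof -
  have "(\<integral>\<^sup>+x. ennreal ((f x)\<^sup>2) \<partial>M) < \<infinity>"
    using le by (rule le_less_trans) simp
  then have int: "integrable M (\<lambda>x. (f x)\<^sup>2)"
    by (intro integrableI_nonneg) auto
  then show "square_integrable M f" by (simp add: square_integrable_def)
  have "ennreal (\<integral>x. (f x)\<^sup>2 \<partial>M) \<le> ennreal c"
    using le by (subst (asm) nn_integral_eq_integral[OF int]) auto
  then show "(\<integral>x. (f x)\<^sup>2 \<partial>M) \<le> c"
    using \<open>0 \<le> c\<close> by (simp add: ennreal_le_iff)
qed

section \<open>Moments of integrals that depend on a parameter\<close>

text \<open>Jensen's inequality for the convex function \<open>y ^ p\<close> and a measure of
  arbitrary finite mass; the normalisation produces the factor with exponent
  \<open>p - 1\<close>.\<close>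

lemma (in finite_measure) power_integral_le:
  fixes f :: "'a \<Rightarrow> real"
  assumes [measurable]: "f \<in> borel_measurable M" and "even p" and "0 < p"
  shows "ennreal ((\<integral>x. f x \<partial>M) ^ p)
    \<le> ennreal (measure M (space M) ^ (p - 1)) * (\<integral>\<^sup>+x. ennreal ((f x) ^ p) \<partial>M)"
proof (cases "measure M (space M) = 0")
  case True
  then have "M = null_measure M"
    by (intro measure_eqI)
       (simp, metis emeasure_eq_measure emeasure_null_measure ennreal_0 le_zero_eq bounded_measure ennreal_leI)
  then have "(\<integral>x. f x \<partial>M) = 0"
    by (metis integral_null_measure)
  then show ?thesis using \<open>0 < p\<close> by (simp add: zero_power)
next
  case False
  define h where "h = measure M (space M)"
  have h: "0 < h" using False by (simp add: h_def zero_less_measure_iff)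
  show ?thesis
  \<comment> \<open>If the right-hand integral is infinite, positivity of the mass makes the whole
    right-hand side infinite. Otherwise \<open>f\<close> is integrable, because its absolute value
    is at most \<open>1 + f x ^ p\<close>.\<close>
  proof (cases "(\<integral>\<^sup>+x. ennreal ((f x) ^ p) \<partial>M) = \<infinity>")
    case True
    then show ?thesis
      using h by (simp add: h_def ennreal_mult_top)
  next
    case False
    have int: "integrable M (\<lambda>x. f x ^ p)"
      using False \<open>even p\<close> by (intro integrableI_nonneg) (auto simp: less_top)
    have f: "integrable M f"
    proof (rule Bochner_Integration.integrable_bound)
      show "integrable M (\<lambda>x. 1 + f x ^ p)" using int by simp
      have "\<bar>y\<bar> \<le> 1 + y ^ p" for y :: real
      proof (cases "\<bar>y\<bar> \<le> 1")
        case True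
        then show ?thesis using zero_le_even_power[OF \<open>even p\<close>, of y] by linarith
      next
        case False
        then have "\<bar>y\<bar> ^ 1 \<le> \<bar>y\<bar> ^ p" using \<open>0 < p\<close> by (intro power_increasing) auto
        then show ?thesis using \<open>even p\<close> by (simp add: power_even_abs)
      qed
      moreover have "0 \<le> 1 + f x ^ p" for x
        using zero_le_even_power[OF \<open>even p\<close>, of "f x"] by linarith
      ultimately show "AE x in M. norm (f x) \<le> norm (1 + f x ^ p)"
        by auto
    qed simp
    define m where "m = (\<integral>x. f x \<partial>M) / h"
    have tangent: "real p * m ^ (p - 1) * (y - m) \<le> y ^ p - m ^ p" for y :: real
    proof (rule convex_on_imp_above_tangent[OF convex_power_even[OF \<open>even p\<close>]])
      show "((\<lambda>x. x ^ p) has_real_derivative real p * m ^ (p - 1)) (at m within UNIV)"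
        by (auto intro!: derivative_eq_intros)
    qed auto
    \<comment> \<open>Integrating the tangent inequality at the mean \<open>m\<close> kills the
      linear term.\<close>
    have "0 \<le> (\<integral>x. f x ^ p - m ^ p - real p * m ^ (p - 1) * (f x - m) \<partial>M)"
      using tangent by (intro Bochner_Integration.integral_nonneg) (simp only: diff_ge_0_iff_ge)
    also have "\<dots> = (\<integral>x. f x ^ p \<partial>M) - h * m ^ p - real p * m ^ (p - 1) * ((\<integral>x. f x \<partial>M) - h * m)"
      using int f by (simp add: h_def algebra_simps)
    also have "\<dots> = (\<integral>x. f x ^ p \<partial>M) - h * m ^ p"
      using h by (simp add: m_def)
    finally have "h ^ (p - 1) * (h * m ^ p) \<le> h ^ (p - 1) * (\<integral>x. f x ^ p \<partial>M)"
      using h by (intro mult_left_mono) auto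
    moreover have "h ^ (p - 1) * (h * m ^ p) = (h * m) ^ p"
      using power_minus_mult[OF \<open>0 < p\<close>, of h] by (simp add: power_mult_distrib flip: mult.assoc)
    moreover have "h * m = (\<integral>x. f x \<partial>M)"
      using h by (simp add: m_def)
    ultimately have "(\<integral>x. f x \<partial>M) ^ p \<le> h ^ (p - 1) * (\<integral>x. f x ^ p \<partial>M)"
      by simp
    then have "ennreal ((\<integral>x. f x \<partial>M) ^ p) \<le> ennreal (h ^ (p - 1)) * ennreal (\<integral>x. f x ^ p \<partial>M)"
      using h by (simp add: ennreal_leI flip: ennreal_mult')
    then show ?thesis
      using \<open>even p\<close> by (subst nn_integral_eq_integral[OF int]) (auto simp: h_def)
  qed
qed

text \<open>Jensen in the variable \<open>a\<close> for each fixed \<open>x\<close>, followed by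
  Tonelli. It is applied with \<open>p = 2\<close> and \<open>p = 4\<close>.\<close>

lemma nn_integral_power_integral_le:
  fixes \<Psi> :: "'a \<Rightarrow> 'b \<Rightarrow> real"
  assumes "finite_measure M" and "finite_measure N"
    and [measurable]: "(\<lambda>(x, a). \<Psi> x a) \<in> borel_measurable (M \<Otimes>\<^sub>M N)"
    and p: "even p" "0 < p"
    and le: "AE a in N. (\<integral>\<^sup>+x. ennreal ((\<Psi> x a) ^ p) \<partial>M) \<le> ennreal W" and "0 \<le> W"
  shows "(\<integral>\<^sup>+x. ennreal ((\<integral>a. \<Psi> x a \<partial>N) ^ p) \<partial>M) \<le> ennreal (measure N (space N) ^ p * W)"
proof -
  interpret M: finite_measure M by fact
  interpret N: finite_measure N by fact
  interpret pair_sigma_finite M N by unfold_locales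
  define h where "h = measure N (space N)"
  have h: "0 \<le> h" by (simp add: h_def)
  have "(\<integral>\<^sup>+x. ennreal ((\<integral>a. \<Psi> x a \<partial>N) ^ p) \<partial>M)
      \<le> (\<integral>\<^sup>+x. ennreal (h ^ (p - 1)) * (\<integral>\<^sup>+a. ennreal ((\<Psi> x a) ^ p) \<partial>N) \<partial>M)"
    unfolding h_def by (intro nn_integral_mono N.power_integral_le p) measurable
  also have "\<dots> = ennreal (h ^ (p - 1)) * (\<integral>\<^sup>+x. (\<integral>\<^sup>+a. ennreal ((\<Psi> x a) ^ p) \<partial>N) \<partial>M)"
    by (intro nn_integral_cmult) measurable
  also have "(\<integral>\<^sup>+x. (\<integral>\<^sup>+a. ennreal ((\<Psi> x a) ^ p) \<partial>N) \<partial>M)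
      = (\<integral>\<^sup>+a. (\<integral>\<^sup>+x. ennreal ((\<Psi> x a) ^ p) \<partial>M) \<partial>N)"
    by (rule Fubini'[symmetric]) measurable
  also have "\<dots> \<le> (\<integral>\<^sup>+a. ennreal W \<partial>N)"
    using le by (intro nn_integral_mono_AE) auto
  also have "\<dots> = ennreal (W * h)"
    using \<open>0 \<le> W\<close> by (simp add: h_def N.emeasure_eq_measure ennreal_mult)
  finally have "(\<integral>\<^sup>+x. ennreal ((\<integral>a. \<Psi> x a \<partial>N) ^ p) \<partial>M) \<le> ennreal (h ^ (p - 1)) * ennreal (W * h)"
    by (simp add: mult_left_mono)
  also have "\<dots> = ennreal (h ^ (p - 1) * (W * h))"
    using h by (simp add: ennreal_mult')
  also have "h ^ (p - 1) * (W * h) = h ^ p * W"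
    using \<open>0 < p\<close> by (metis mult.assoc mult.commute power_minus_mult)
  finally show ?thesis by (simp add: h_def)
qed

text \<open>Fubini applies because the product is dominated by the sum of the two squares, whose
  integral over \<open>M\<close> is bounded uniformly in \<open>a\<close>, and \<open>N\<close> is
  finite.\<close>

lemma integral_mult_integral_eq:
  fixes \<Psi> :: "'a \<Rightarrow> 'b \<Rightarrow> real"
  assumes "finite_measure M" and "finite_measure N"
    and [measurable]: "(\<lambda>(x, a). \<Psi> x a) \<in> borel_measurable (M \<Otimes>\<^sub>M N)"
    and Z: "square_integrable M Z"
    and \<Psi>: "AE a in N. square_integrable M (\<lambda>x. \<Psi> x a) \<and> (\<integral>x. (\<Psi> x a)\<^sup>2 \<partial>M) \<le> W"
  shows "integrable N (\<lambda>a. \<integral>x. Z x * \<Psi> x a \<partial>M)"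
    and "(\<integral>x. Z x * (\<integral>a. \<Psi> x a \<partial>N) \<partial>M) = (\<integral>a. (\<integral>x. Z x * \<Psi> x a \<partial>M) \<partial>N)"
proof -
  interpret M: finite_measure M by fact
  interpret N: finite_measure N by fact
  interpret pair_sigma_finite M N by unfold_locales
  have [measurable]: "Z \<in> borel_measurable M"
    using Z by (simp add: square_integrable_def)
  define c where "c = (\<integral>x. (Z x)\<^sup>2 \<partial>M) + W"
  have int: "integrable (M \<Otimes>\<^sub>M N) (\<lambda>(x, a). Z x * \<Psi> x a)"
  proof (rule integrableI_bounded)
    have "(\<integral>\<^sup>+z. ennreal (norm (case z of (x, a) \<Rightarrow> Z x * \<Psi> x a)) \<partial>(M \<Otimes>\<^sub>M N))
        = (\<integral>\<^sup>+a. (\<integral>\<^sup>+x. ennreal (norm (Z x * \<Psi> x a)) \<partial>M) \<partial>N)"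
      by (subst nn_integral_snd[symmetric]) (auto simp: split_beta')
    also have "\<dots> \<le> (\<integral>\<^sup>+a. ennreal c \<partial>N)"
    proof (rule nn_integral_mono_AE)
      show "AE a in N. (\<integral>\<^sup>+x. ennreal (norm (Z x * \<Psi> x a)) \<partial>M) \<le> ennreal c"
        using \<Psi>
      proof eventually_elim
        case (elim a)
        have int: "integrable M (\<lambda>x. (Z x)\<^sup>2 + (\<Psi> x a)\<^sup>2)"
          using elim Z by (auto simp: square_integrable_def)
        have "(\<integral>\<^sup>+x. ennreal (norm (Z x * \<Psi> x a)) \<partial>M)
            \<le> (\<integral>\<^sup>+x. ennreal ((Z x)\<^sup>2 + (\<Psi> x a)\<^sup>2) \<partial>M)"
          using abs_mult_le_sum_squares by (intro nn_integral_mono ennreal_leI) auto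
        also have "\<dots> = ennreal (\<integral>x. (Z x)\<^sup>2 + (\<Psi> x a)\<^sup>2 \<partial>M)"
          by (rule nn_integral_eq_integral[OF int]) auto
        also have "\<dots> \<le> ennreal c"
          using elim Z by (intro ennreal_leI) (auto simp: c_def square_integrable_def)
        finally show ?case .
      qed
    qed
    also have "\<dots> < \<infinity>"
      by (simp add: N.emeasure_eq_measure ennreal_mult_less_top)
    finally show "(\<integral>\<^sup>+z. ennreal (norm (case z of (x, a) \<Rightarrow> Z x * \<Psi> x a)) \<partial>(M \<Otimes>\<^sub>M N)) < \<infinity>" .
  qed measurable
  show "integrable N (\<lambda>a. \<integral>x. Z x * \<Psi> x a \<partial>M)"
    by (rule integrable_snd[OF int])
  show "(\<integral>x. Z x * (\<integral>a. \<Psi> x a \<partial>N) \<partial>M) = (\<integral>a. (\<integral>x. Z x * \<Psi> x a \<partial>M) \<partial>N)"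
    using Fubini_integral[OF int] by simp
qed

text \<open>The square of the integral is expanded one factor at a time, so that its expectation
  becomes the double integral of the covariance kernel. \<open>W\<close> secures integrability; the
  bound comes from \<open>\<kappa>\<close>, which controls the integral of each row of the
  kernel.\<close>

lemma integral_square_integral_le:
  fixes \<Psi> :: "'a \<Rightarrow> 'b \<Rightarrow> real"
  assumes fin: "finite_measure M" "finite_measure N"
    and meas: "(\<lambda>(x, a). \<Psi> x a) \<in> borel_measurable (M \<Otimes>\<^sub>M N)"
    and \<Psi>: "AE a in N. square_integrable M (\<lambda>x. \<Psi> x a) \<and> (\<integral>x. (\<Psi> x a)\<^sup>2 \<partial>M) \<le> W" and "0 \<le> W"
    and cov: "AE a in N. (\<integral>b. (\<integral>x. \<Psi> x a * \<Psi> x b \<partial>M) \<partial>N) \<le> \<kappa>"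
  shows "square_integrable M (\<lambda>x. \<integral>a. \<Psi> x a \<partial>N)"
    and "(\<integral>x. (\<integral>a. \<Psi> x a \<partial>N)\<^sup>2 \<partial>M) \<le> measure N (space N) * \<kappa>"
proof -
  interpret N: finite_measure N by (rule fin)
  note [measurable] = meas
  have "AE a in N. (\<integral>\<^sup>+x. ennreal ((\<Psi> x a)\<^sup>2) \<partial>M) \<le> ennreal W"
    using \<Psi>
  proof eventually_elim
    case (elim a)
    then show ?case
      by (subst nn_integral_eq_integral) (auto simp: square_integrable_def ennreal_leI)
  qed
  from nn_integral_power_integral_le[OF fin meas _ _ this \<open>0 \<le> W\<close>]
  have "(\<integral>\<^sup>+x. ennreal ((\<integral>a. \<Psi> x a \<partial>N)\<^sup>2) \<partial>M) \<le> ennreal (measure N (space N) ^ 2 * W)"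
    by simp
  then show R: "square_integrable M (\<lambda>x. \<integral>a. \<Psi> x a \<partial>N)"
    by (rule square_integrable_if_nn_integral_le(1)[rotated]) (use \<open>0 \<le> W\<close> in auto)
  note outer = integral_mult_integral_eq[OF fin meas R \<Psi>]
  have "(\<integral>x. (\<integral>a. \<Psi> x a \<partial>N)\<^sup>2 \<partial>M)
      = (\<integral>a. (\<integral>x. (\<integral>b. \<Psi> x b \<partial>N) * \<Psi> x a \<partial>M) \<partial>N)"
    using outer(2) by (simp add: power2_eq_square)
  also have "\<dots> \<le> (\<integral>a. \<kappa> \<partial>N)"
  proof (rule integral_mono_AE[OF outer(1)])
    show "AE a in N. (\<integral>x. (\<integral>b. \<Psi> x b \<partial>N) * \<Psi> x a \<partial>M) \<le> \<kappa>"
      using \<Psi> cov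
    proof eventually_elim
      case (elim a)
      then have "(\<integral>x. \<Psi> x a * (\<integral>b. \<Psi> x b \<partial>N) \<partial>M) = (\<integral>b. (\<integral>x. \<Psi> x a * \<Psi> x b \<partial>M) \<partial>N)"
        by (intro integral_mult_integral_eq(2)[OF fin meas _ \<Psi>]) auto
      with elim show ?case by (simp add: mult.commute)
    qed
  qed simp
  finally show "(\<integral>x. (\<integral>a. \<Psi> x a \<partial>N)\<^sup>2 \<partial>M) \<le> measure N (space N) * \<kappa>"
    by simp
qed

section \<open>Completeness of the space of square integrable functions\<close>

text \<open>Fatou's lemma applied to the squares.\<close>

lemma square_integrable_AE_limit:
  assumes meas: "\<And>n. f n \<in> borel_measurable M" and A: "A \<in> borel_measurable M"
    and lim: "AE x in M. (\<lambda>n. f n x) \<longlonglongrightarrow> A x"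
    and bnd: "\<And>n. n0 \<le> n \<Longrightarrow> square_integrable M (f n) \<and> (\<integral>x. (f n x)\<^sup>2 \<partial>M) \<le> c"
  shows "square_integrable M A" and "(\<integral>x. (A x)\<^sup>2 \<partial>M) \<le> c"
proof -
  note [measurable] = meas A
  have "0 \<le> (\<integral>x. (f n0 x)\<^sup>2 \<partial>M)" by simp
  then have c: "0 \<le> c" using bnd[of n0] by linarith
  have "(\<integral>\<^sup>+x. ennreal ((A x)\<^sup>2) \<partial>M) = (\<integral>\<^sup>+x. liminf (\<lambda>n. ennreal ((f n x)\<^sup>2)) \<partial>M)"
  proof (rule nn_integral_cong_AE)
    show "AE x in M. ennreal ((A x)\<^sup>2) = liminf (\<lambda>n. ennreal ((f n x)\<^sup>2))"
      using lim
    proof eventually_elim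
      case (elim x)
      then have "(\<lambda>n. ennreal ((f n x)\<^sup>2)) \<longlonglongrightarrow> ennreal ((A x)\<^sup>2)"
        by (intro tendsto_intros)
      then show ?case
        by (intro lim_imp_Liminf[symmetric]) auto
    qed
  qed
  also have "\<dots> \<le> liminf (\<lambda>n. \<integral>\<^sup>+x. ennreal ((f n x)\<^sup>2) \<partial>M)"
    by (rule nn_integral_liminf) measurable
  also have "\<dots> \<le> limsup (\<lambda>n. \<integral>\<^sup>+x. ennreal ((f n x)\<^sup>2) \<partial>M)"
    by (intro Liminf_le_Limsup) simp
  also have "\<dots> \<le> ennreal c"
  proof (rule Limsup_bounded, rule eventually_sequentiallyI)
    fix n assume "n0 \<le> n"
    from bnd[OF this] show "(\<integral>\<^sup>+x. ennreal ((f n x)\<^sup>2) \<partial>M) \<le> ennreal c"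
      by (subst nn_integral_eq_integral) (auto simp: square_integrable_def ennreal_leI)
  qed
  finally have "(\<integral>\<^sup>+x. ennreal ((A x)\<^sup>2) \<partial>M) \<le> ennreal c" .
  from square_integrable_if_nn_integral_le[OF A this c]
  show "square_integrable M A" and "(\<integral>x. (A x)\<^sup>2 \<partial>M) \<le> c" .
qed

text \<open>The Riesz-Fischer argument: geometrically small steps are absolutely summable almost
  everywhere, so the sequence telescopes to a limit. The witness is the pointwise
  \<open>lim\<close>, which is measurable whether or not the sequence converges.\<close>

lemma square_integrable_fast_Cauchy:
  assumes "finite_measure M" and f: "\<And>n. square_integrable M (f n)"
    and Cauchy: "\<And>n. (\<integral>x. (f (Suc n) x - f n x)\<^sup>2 \<partial>M) \<le> (1 / 4) ^ n"
  obtains A where "A \<in> borel_measurable M" and "AE x in M. (\<lambda>n. f n x) \<longlonglongrightarrow> A x"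
proof
  interpret finite_measure M by fact
  define d where "d n x = f (Suc n) x - f n x" for n x
  have d: "square_integrable M (d n)" for n
    unfolding d_def by (intro square_integrable_diff f)
  have [measurable]: "f n \<in> borel_measurable M" "d n \<in> borel_measurable M" for n
    using f d by (auto simp: square_integrable_def)
  show "(\<lambda>x. lim (\<lambda>n. f n x)) \<in> borel_measurable M"
    by measurable
  define h where "h = measure M (space M)"
  have le: "(\<integral>\<^sup>+x. ennreal \<bar>d n x\<bar> \<partial>M) \<le> ennreal ((1 + h) * (1 / 2) ^ n)" for n
  proof -
    have int: "integrable M (\<lambda>x. 2 ^ n * (d n x)\<^sup>2 + (1 / 2) ^ n)"
      using d[of n] by (auto simp: square_integrable_def)
    \<comment> \<open>The weight \<open>2 ^ n\<close> balances the two terms: the second moment is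
      at most \<open>(1 / 4) ^ n\<close>, so both contributions are of order
      \<open>(1 / 2) ^ n\<close>.\<close>
    have "\<bar>y\<bar> \<le> 2 ^ n * y\<^sup>2 + (1 / 2) ^ n" for y :: real
    proof -
      have "0 \<le> (2 ^ n * \<bar>y\<bar> - 1)\<^sup>2 / 2 ^ n" by simp
      also have "\<dots> = 2 ^ n * y\<^sup>2 + (1 / 2) ^ n - 2 * \<bar>y\<bar>"
        by (simp add: power2_diff field_simps power2_eq_square)
      finally show ?thesis using abs_ge_zero[of y] by linarith
    qed
    then have "(\<integral>\<^sup>+x. ennreal \<bar>d n x\<bar> \<partial>M) \<le> (\<integral>\<^sup>+x. ennreal (2 ^ n * (d n x)\<^sup>2 + (1 / 2) ^ n) \<partial>M)"
      by (intro nn_integral_mono ennreal_leI)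
    also have "\<dots> = ennreal (\<integral>x. 2 ^ n * (d n x)\<^sup>2 + (1 / 2) ^ n \<partial>M)"
      by (rule nn_integral_eq_integral[OF int]) auto
    also have "(\<integral>x. 2 ^ n * (d n x)\<^sup>2 + (1 / 2) ^ n \<partial>M) = 2 ^ n * (\<integral>x. (d n x)\<^sup>2 \<partial>M) + (1 / 2) ^ n * h"
      using d[of n] by (simp add: square_integrable_def h_def mult.commute)
    also have "ennreal \<dots> \<le> ennreal (2 ^ n * (1 / 4) ^ n + (1 / 2) ^ n * h)"
      using Cauchy[of n] by (intro ennreal_leI add_right_mono mult_left_mono) (auto simp: d_def)
    also have "2 ^ n * (1 / 4) ^ n + (1 / 2) ^ n * h = (1 + h) * (1 / 2 :: real) ^ n"
      by (simp add: algebra_simps flip: power_mult_distrib)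
    finally show ?thesis .
  qed
  have "(\<integral>\<^sup>+x. (\<Sum>n. ennreal \<bar>d n x\<bar>) \<partial>M) = (\<Sum>n. \<integral>\<^sup>+x. ennreal \<bar>d n x\<bar> \<partial>M)"
    by (rule nn_integral_suminf) measurable
  also have "\<dots> \<le> (\<Sum>n. ennreal ((1 + h) * (1 / 2) ^ n))"
    by (intro suminf_le le) auto
  also have "\<dots> < \<infinity>"
  proof -
    have "summable (\<lambda>n. (1 + h) * (1 / 2) ^ n)"
      by (intro summable_mult summable_geometric) simp
    then show ?thesis
      using measure_nonneg[of M "space M"]
      by (subst suminf_ennreal2) (auto simp: h_def)
  qed
  finally have "AE x in M. (\<Sum>n. ennreal \<bar>d n x\<bar>) \<noteq> \<infinity>"
    by (intro nn_integral_PInf_AE) auto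
  then show "AE x in M. (\<lambda>n. f n x) \<longlonglongrightarrow> lim (\<lambda>n. f n x)"
  proof eventually_elim
    case (elim x)
    then have "summable (\<lambda>n. \<bar>d n x\<bar>)"
      by (intro summable_suminf_not_top) auto
    then have "summable (\<lambda>n. d n x)"
      by (rule summable_rabs_cancel)
    then have "convergent (\<lambda>n. f 0 x + (\<Sum>k<n. d k x))"
      by (intro convergent_add convergent_const) (simp add: summable_iff_convergent)
    moreover have "f 0 x + (\<Sum>k<n. d k x) = f n x" for n
      using sum_lessThan_telescope[of "\<lambda>k. f k x" n] by (simp add: d_def)
    ultimately show ?case
      by (simp add: convergent_LIMSEQ_iff)
  qed
qed

text \<open>Cauchy criterion for a family indexed by divisions, where \<open>D \<eta>\<close> stands
  for those of mesh below \<open>\<eta>\<close>. A sequence with rapidly shrinking mesh yields a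
  candidate \<open>A\<close>; any other fine division is then compared with that sequence, and the
  estimate passes to the limit.\<close>

lemma L2_limit_exists:
  fixes S :: "'p \<Rightarrow> 'a \<Rightarrow> real"
  assumes fin: "finite_measure M"
    and D: "\<And>\<eta>. 0 < \<eta> \<Longrightarrow> D \<eta> \<noteq> {}" "\<And>\<eta> \<eta>'. \<eta> \<le> \<eta>' \<Longrightarrow> D \<eta> \<subseteq> D \<eta>'"
    and S: "\<And>\<eta> p. p \<in> D \<eta> \<Longrightarrow> square_integrable M (S p)"
    and Cauchy: "\<And>\<eta> p q. 0 < \<eta> \<Longrightarrow> p \<in> D \<eta> \<Longrightarrow> q \<in> D \<eta> \<Longrightarrow>
      (\<integral>x. (S p x - S q x)\<^sup>2 \<partial>M) \<le> c * \<eta>"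
  shows "\<exists>A. square_integrable M A \<and>
    (\<forall>\<epsilon>>0. \<exists>\<eta>>0. \<forall>p\<in>D \<eta>. L2_norm M (\<lambda>x. S p x - A x) < \<epsilon>)"
proof -
  \<comment> \<open>\<open>c\<close> may be zero or negative; \<open>b\<close> is a positive upper
    bound by which one may divide.\<close>
  define b where "b = max c 1"
  have b: "0 < b" "c \<le> b" by (auto simp: b_def)
  define e where "e n = (1 / 4) ^ n / b" for n
  have e: "0 < e n" for n using b by (simp add: e_def)
  have e_mono: "e m \<le> e n" if "n \<le> m" for m n
    using that b by (auto simp: e_def intro!: divide_right_mono power_decreasing)
  have "\<exists>p. \<forall>n. p n \<in> D (e n)"
    using D(1)[OF e] by (intro choice) auto
  then obtain p where p: "p n \<in> D (e n)" for n by blast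
  have ce: "c * e n \<le> (1 / 4) ^ n" for n
  proof -
    have "c * e n \<le> b * e n" using b e[of n] by (intro mult_right_mono) auto
    then show ?thesis using b by (simp add: e_def)
  qed
  have dist: "(\<integral>x. (S q x - S (p m) x)\<^sup>2 \<partial>M) \<le> (1 / 4) ^ n"
    if "q \<in> D (e n)" "n \<le> m" for q m n
    using Cauchy[OF e[of n] that(1), of "p m"] p[of m] D(2)[OF e_mono[OF that(2)]] ce[of n] by auto
  obtain A where A: "A \<in> borel_measurable M" "AE x in M. (\<lambda>n. S (p n) x) \<longlonglongrightarrow> A x"
  proof (rule square_integrable_fast_Cauchy[OF fin, of "\<lambda>n. S (p n)"])
    show "square_integrable M (S (p n))" for n using S[OF p] .
    show "(\<integral>x. (S (p (Suc n)) x - S (p n) x)\<^sup>2 \<partial>M) \<le> (1 / 4) ^ n" for n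
      using D(2)[OF e_mono[of n "Suc n"]] p[of "Suc n"] by (intro dist) auto
  qed
  have diff: "square_integrable M (\<lambda>x. S q x - A x) \<and> (\<integral>x. (S q x - A x)\<^sup>2 \<partial>M) \<le> (1 / 4) ^ n"
    if q: "q \<in> D (e n)" for q n
  proof -
    have lim: "AE x in M. (\<lambda>m. S q x - S (p m) x) \<longlonglongrightarrow> S q x - A x"
      using A(2) by eventually_elim (intro tendsto_intros)
    have si: "square_integrable M (\<lambda>x. S q x - S (p m) x)" for m
      using S[OF q] S[OF p] by (rule square_integrable_diff)
    have "S q \<in> borel_measurable M"
      using S[OF q] by (simp add: square_integrable_def)
    then show ?thesis
      using square_integrable_AE_limit[OF _ _ lim, of n "(1 / 4) ^ n"] A(1) si dist[OF q]
      by (auto simp: square_integrable_def)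
  qed
  \<comment> \<open>\<open>A\<close> is the difference of \<open>S (p 0)\<close> and
    \<open>S (p 0) - A\<close>.\<close>
  have "square_integrable M A"
    using square_integrable_diff[OF S[OF p[of 0]] conjunct1[OF diff[OF p[of 0]]]] by simp
  moreover have "\<exists>\<eta>>0. \<forall>q\<in>D \<eta>. L2_norm M (\<lambda>x. S q x - A x) < \<epsilon>" if \<epsilon>: "0 < \<epsilon>" for \<epsilon>
  proof -
    obtain n where n: "(1 / 4 :: real) ^ n < \<epsilon>\<^sup>2"
      using real_arch_pow_inv[of "\<epsilon>\<^sup>2" "1 / 4"] \<epsilon> by auto
    have "L2_norm M (\<lambda>x. S q x - A x) < \<epsilon>" if "q \<in> D (e n)" for q
    proof -
      have "(\<integral>x. (S q x - A x)\<^sup>2 \<partial>M) < \<epsilon>\<^sup>2"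
        using diff[OF that] n by linarith
      then have "sqrt (\<integral>x. (S q x - A x)\<^sup>2 \<partial>M) < sqrt (\<epsilon>\<^sup>2)"
        by (rule real_sqrt_less_mono)
      then show ?thesis using \<epsilon> by (simp add: L2_norm_def)
    qed
    then show ?thesis using e by blast
  qed
  ultimately show ?thesis by blast
qed

subsection \<open>The smoothing remainder of a path\<close>

abbreviation path_space :: "(real \<Rightarrow> real) measure" where
  "path_space \<equiv> \<Pi>\<^sub>M t\<in>UNIV. borel"

abbreviation lborel_on :: "real \<Rightarrow> real \<Rightarrow> real measure" where
  "lborel_on a b \<equiv> restrict_space lborel {a..b}"

text \<open>
  Evaluation \<open>(f, r) \<mapsto> f r\<close> is not measurable for the product sigma-algebra on arbitrary paths. This
  measurable substitute agrees with it on continuous paths, so path integrals become measurable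
  functionals of the path, to which independence applies.
\<close>

definition path_eval :: "(real \<Rightarrow> real) \<Rightarrow> real \<Rightarrow> real" where
  "path_eval f r = lim (\<lambda>n. f (of_int \<lfloor>real (Suc n) * r\<rfloor> / real (Suc n)))"

text \<open>This is \<open>smoothing_error\<close> for a single scalar path: the estimates involve
  one or two coordinates at a time, and independence is a property of whole coordinate
  paths.\<close>

definition smoothing_remainder :: "real \<Rightarrow> (real \<Rightarrow> real) \<Rightarrow> real \<Rightarrow> real" where
  "smoothing_remainder \<delta> f t = (1 / \<delta>) * (LBINT r=ereal 0..ereal t. f (\<delta> + r) - f r) - f t"

definition increment :: "real \<Rightarrow> (real \<Rightarrow> real) \<Rightarrow> real \<Rightarrow> real \<Rightarrow> real" where
  "increment \<delta> f a b = smoothing_remainder \<delta> f b - smoothing_remainder \<delta> f a"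

text \<open>A version of \<open>increment\<close> that is measurable on all of
  \<open>path_space\<close> and agrees with it on continuous paths when
  \<open>a \<le> b\<close>.\<close>

definition increment_functional :: "real \<Rightarrow> real \<Rightarrow> real \<Rightarrow> (real \<Rightarrow> real) \<Rightarrow> real" where
  "increment_functional \<delta> a b f =
     (\<integral>r. (path_eval f (\<delta> + r) - path_eval f r) / \<delta> \<partial>lborel_on a b) - (f b - f a)"

lemma path_component_measurable [measurable]: "(\<lambda>f. f t) \<in> borel_measurable path_space"
  by (rule measurable_component_singleton) simp

text \<open>For fixed \<open>n\<close> the rounded time takes countably many values, so the
  evaluation is a countable case distinction between coordinate maps.\<close>

lemma path_eval_measurable [measurable (raw)]:
  assumes [measurable]: "f \<in> measurable M path_space" "g \<in> borel_measurable M"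
  shows "(\<lambda>z. path_eval (f z) (g z)) \<in> borel_measurable M"
proof -
  have "(\<lambda>z. f z (of_int \<lfloor>real (Suc n) * g z\<rfloor> / real (Suc n))) \<in> borel_measurable M" for n
    by (rule measurable_compose_countable
          [where f="\<lambda>k z. f z (of_int k / real (Suc n))" and g="\<lambda>z. \<lfloor>real (Suc n) * g z\<rfloor>"])
       (auto intro: measurable_compose[OF assms(1) path_component_measurable])
  then show ?thesis
    unfolding path_eval_def by (intro borel_measurable_lim_metric) simp
qed

lemma path_eval_eq:
  assumes "continuous_on UNIV f"
  shows "path_eval f r = f r"
proof -
  have "(\<lambda>n. of_int \<lfloor>real (Suc n) * r\<rfloor> / real (Suc n)) \<longlonglongrightarrow> r"
  proof (rule real_tendsto_sandwich)
    show "\<forall>\<^sub>F n in sequentially. r - 1 / real (Suc n) \<le> of_int \<lfloor>real (Suc n) * r\<rfloor> / real (Suc n)"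
    proof (rule always_eventually, rule allI)
      fix n
      have "real (Suc n) * r - 1 \<le> of_int \<lfloor>real (Suc n) * r\<rfloor>" by linarith
      then have "(real (Suc n) * r - 1) / real (Suc n) \<le> of_int \<lfloor>real (Suc n) * r\<rfloor> / real (Suc n)"
        by (intro divide_right_mono) auto
      then show "r - 1 / real (Suc n) \<le> of_int \<lfloor>real (Suc n) * r\<rfloor> / real (Suc n)"
        by (simp add: diff_divide_distrib)
    qed
    show "\<forall>\<^sub>F n in sequentially. of_int \<lfloor>real (Suc n) * r\<rfloor> / real (Suc n) \<le> r"
      by (intro always_eventually allI) (simp add: pos_divide_le_eq mult.commute)
    have "(\<lambda>n. r - 1 / real (Suc n)) \<longlonglongrightarrow> r - 0"
      by (intro tendsto_intros LIMSEQ_Suc lim_1_over_n)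
    then show "(\<lambda>n. r - 1 / real (Suc n)) \<longlonglongrightarrow> r" by simp
  qed simp
  moreover have "isCont f r"
    using assms by (simp add: continuous_on_eq_continuous_at)
  ultimately have "(\<lambda>n. f (of_int \<lfloor>real (Suc n) * r\<rfloor> / real (Suc n))) \<longlonglongrightarrow> f r"
    by (rule isCont_tendsto_compose[rotated])
  then show ?thesis
    unfolding path_eval_def by (rule limI)
qed

lemma finite_measure_lborel_on [simp, intro]: "finite_measure (lborel_on a b)"
  by (rule finite_measureI) (simp add: emeasure_restrict_space space_restrict_space emeasure_lborel_Icc_eq)

lemma snd_measurable_lborel_on [measurable]: "snd \<in> borel_measurable (M \<Otimes>\<^sub>M lborel_on a b)"
  by (rule measurable_compose[OF measurable_snd]) (simp add: measurable_restrict_space1)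

lemma measure_lborel_on: "a \<le> b \<Longrightarrow> measure (lborel_on a b) (space (lborel_on a b)) = b - a"
  by (simp add: measure_restrict_space space_restrict_space)

lemma increment_functional_measurable [measurable]:
  "increment_functional \<delta> a b \<in> borel_measurable path_space"
proof -
  interpret finite_measure "lborel_on a b" by simp
  have "(\<lambda>(f, r). (path_eval f (\<delta> + r) - path_eval f r) / \<delta>)
    \<in> borel_measurable (path_space \<Otimes>\<^sub>M lborel_on a b)"
    unfolding split_beta' by measurable
  then show ?thesis
    unfolding increment_functional_def by measurable
qed

lemma integrable_lborel_on:
  fixes f :: "real \<Rightarrow> real"
  assumes "continuous_on {a..b} f"
  shows "integrable (lborel_on a b) f"
  using borel_integrable_atLeastAtMost'[OF assms]
  by (simp add: integrable_restrict_space set_integrable_def)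

lemma LBINT_eq_integral_lborel_on:
  fixes f :: "real \<Rightarrow> real"
  assumes "a \<le> b"
  shows "(LBINT r=ereal a..ereal b. f r) = (\<integral>r. f r \<partial>lborel_on a b)"
  using assms by (simp add: interval_integral_Icc integral_restrict_space set_lebesgue_integral_def)

section \<open>Two representations of the increments\<close>

lemma LBINT_sum:
  fixes f :: "real \<Rightarrow> real"
  assumes "continuous_on UNIV f"
  shows "(LBINT r=ereal a..ereal b. f r) + (LBINT r=ereal b..ereal c. f r) = (LBINT r=ereal a..ereal c. f r)"
proof (rule interval_integral_sum)
  have "interval_lebesgue_integrable lborel (ereal (min a (min b c))) (ereal (max a (max b c))) f"
    using assms by (intro interval_integrable_isCont) (simp add: continuous_on_eq_continuous_at)
  then show "interval_lebesgue_integrable lborel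
      (min (ereal a) (min (ereal b) (ereal c))) (max (ereal a) (max (ereal b) (ereal c))) f"
    by (simp add: ereal_min ereal_max)
qed

text \<open>The splitting into an absolutely continuous part and an increment of the path itself. It
  is the efficient form for intervals shorter than \<open>\<delta>\<close>, and it drives the
  estimate of the step sums.\<close>

lemma increment_eq:
  assumes f: "continuous_on UNIV f" and "a \<le> b"
  shows "increment \<delta> f a b = (\<integral>r. (f (\<delta> + r) - f r) / \<delta> \<partial>lborel_on a b) - (f b - f a)"
proof -
  have "continuous_on UNIV (\<lambda>r. f (\<delta> + r) - f r)"
    by (intro continuous_intros continuous_on_compose2[OF f]) auto
  from LBINT_sum[OF this, of 0 a b]
  have "(LBINT r=ereal 0..ereal b. f (\<delta> + r) - f r) - (LBINT r=ereal 0..ereal a. f (\<delta> + r) - f r)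
      = (\<integral>r. f (\<delta> + r) - f r \<partial>lborel_on a b)"
    using \<open>a \<le> b\<close> by (simp add: LBINT_eq_integral_lborel_on)
  then show ?thesis
    by (simp add: increment_def smoothing_remainder_def diff_divide_distrib[symmetric]
        flip: right_diff_distrib)
qed

text \<open>Shifting the integration variable turns the remainder at time \<open>t\<close> into an
  average over a window of length \<open>\<delta>\<close>. The size of both terms is governed by
  \<open>\<delta>\<close> alone, which suits long intervals.\<close>

lemma increment_eq_moving_average:
  assumes f: "continuous_on UNIV f" and "0 < \<delta>" and "0 \<le> a" "0 \<le> b"
  shows "increment \<delta> f a b = (\<integral>r. (f r - f b) / \<delta> \<partial>lborel_on b (b + \<delta>))
    - (\<integral>r. (f r - f a) / \<delta> \<partial>lborel_on a (a + \<delta>))"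
proof -
  define F where "F t = (LBINT r=ereal 0..ereal t. f r)" for t
  have int: "interval_lebesgue_integrable lborel (ereal s) (ereal t) f" for s t
    using f by (intro interval_integrable_isCont) (simp add: continuous_on_eq_continuous_at)
  have shift: "(LBINT r=ereal 0..ereal t. f (\<delta> + r)) = F (t + \<delta>) - F \<delta>"
    if "0 \<le> t" for t
  proof -
    have "(LBINT r=ereal 0..ereal t. 1 *\<^sub>R f (\<delta> + r)) = (LBINT r=ereal (\<delta> + 0)..ereal (\<delta> + t). f r)"
      using that by (intro interval_integral_substitution_finite)
        (auto intro!: derivative_eq_intros continuous_on_subset[OF f])
    then have "(LBINT r=ereal 0..ereal t. f (\<delta> + r)) = (LBINT r=ereal \<delta>..ereal (t + \<delta>). f r)"
      by (simp add: add.commute)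
    then show ?thesis
      using LBINT_sum[OF f, of 0 \<delta> "t + \<delta>"] by (simp add: F_def)
  qed
  have int_shift: "interval_lebesgue_integrable lborel (ereal 0) (ereal t) (\<lambda>r. f (\<delta> + r))" for t
  proof (intro interval_integrable_isCont)
    have "continuous_on UNIV (\<lambda>r. f (\<delta> + r))"
      by (intro continuous_on_compose2[OF f] continuous_intros) auto
    then show "isCont (\<lambda>r. f (\<delta> + r)) r" for r
      by (simp add: continuous_on_eq_continuous_at)
  qed
  \<comment> \<open>The term \<open>F \<delta> / \<delta>\<close> does not depend on
    \<open>t\<close> and cancels in the increment.\<close>
  have "smoothing_remainder \<delta> f t = (F (t + \<delta>) - F t) / \<delta> - F \<delta> / \<delta> - f t" if "0 \<le> t" for t
    using int_shift[of t] int[of 0 t] that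
    by (simp add: smoothing_remainder_def interval_lebesgue_integral_diff shift F_def diff_divide_distrib)
  moreover have "(\<integral>r. (f r - f t) / \<delta> \<partial>lborel_on t (t + \<delta>)) = (F (t + \<delta>) - F t) / \<delta> - f t" for t
  proof -
    interpret finite_measure "lborel_on t (t + \<delta>)" by simp
    have "integrable (lborel_on t (t + \<delta>)) f"
      by (intro integrable_lborel_on continuous_on_subset[OF f]) auto
    then have "(\<integral>r. (f r - f t) / \<delta> \<partial>lborel_on t (t + \<delta>))
        = ((\<integral>r. f r \<partial>lborel_on t (t + \<delta>)) - \<delta> * f t) / \<delta>"
      using \<open>0 < \<delta>\<close> measure_lborel_on[of t "t + \<delta>"] by simp
    also have "(\<integral>r. f r \<partial>lborel_on t (t + \<delta>)) = F (t + \<delta>) - F t"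
      using LBINT_sum[OF f, of 0 t "t + \<delta>"] \<open>0 < \<delta>\<close>
      by (simp add: F_def LBINT_eq_integral_lborel_on)
    finally show ?thesis using \<open>0 < \<delta>\<close> by (simp add: diff_divide_distrib)
  qed
  ultimately show ?thesis
    using assms by (simp add: increment_def)
qed

lemma increment_functional_eq:
  assumes "continuous_on UNIV f" and "a \<le> b"
  shows "increment_functional \<delta> a b f = increment \<delta> f a b"
  using assms by (simp add: increment_functional_def increment_eq path_eval_eq)

lemma nn_integral_power4_diff_le:
  fixes u v :: "'a \<Rightarrow> real"
  assumes [measurable]: "u \<in> borel_measurable M" "v \<in> borel_measurable M"
    and "(\<integral>\<^sup>+x. ennreal (u x ^ 4) \<partial>M) \<le> ennreal c" and "(\<integral>\<^sup>+x. ennreal (v x ^ 4) \<partial>M) \<le> ennreal d"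
    and "0 \<le> c" "0 \<le> d"
  shows "(\<integral>\<^sup>+x. ennreal ((u x - v x) ^ 4) \<partial>M) \<le> ennreal (8 * c + 8 * d)"
proof -
  have "(p - q) ^ 4 \<le> 8 * p ^ 4 + 8 * q ^ 4" for p q :: real
  proof -
    have "(p - q)\<^sup>2 \<le> 2 * p\<^sup>2 + 2 * q\<^sup>2"
      using zero_le_power2[of "p + q"] by (simp add: power2_sum power2_diff)
    then have "((p - q)\<^sup>2)\<^sup>2 \<le> (2 * p\<^sup>2 + 2 * q\<^sup>2)\<^sup>2"
      by (rule power_mono) simp
    also have "\<dots> \<le> 8 * (p\<^sup>2)\<^sup>2 + 8 * (q\<^sup>2)\<^sup>2"
      using zero_le_power2[of "p\<^sup>2 - q\<^sup>2"] by (simp add: power2_sum power2_diff power_mult_distrib)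
    finally show ?thesis by simp
  qed
  then have "(\<integral>\<^sup>+x. ennreal ((u x - v x) ^ 4) \<partial>M) \<le> (\<integral>\<^sup>+x. ennreal (8 * u x ^ 4 + 8 * v x ^ 4) \<partial>M)"
    by (intro nn_integral_mono ennreal_leI)
  also have "\<dots> = ennreal 8 * (\<integral>\<^sup>+x. ennreal (u x ^ 4) \<partial>M) + ennreal 8 * (\<integral>\<^sup>+x. ennreal (v x ^ 4) \<partial>M)"
    by (simp add: ennreal_plus ennreal_mult' nn_integral_add nn_integral_cmult)
  also have "\<dots> \<le> ennreal 8 * ennreal c + ennreal 8 * ennreal d"
    using assms by (intro add_mono mult_left_mono) auto
  also have "\<dots> = ennreal (8 * c + 8 * d)"
    using assms by (simp add: ennreal_plus ennreal_mult')
  finally show ?thesis .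
qed

subsection \<open>Moments of the increments\<close>

text \<open>The second moments determine all covariances of increments by polarization, and the
  fourth moments control squares of increments. Stating the latter as a nonnegative integral
  includes finiteness.\<close>

locale brownian_moments = prob_space P for P :: "'a measure" +
  fixes B :: "'a \<Rightarrow> real \<Rightarrow> real"
  assumes paths [measurable]: "B \<in> measurable P path_space"
    and continuous_path: "x \<in> space P \<Longrightarrow> continuous_on UNIV (B x)"
    and square_integrable_diff_path: "square_integrable P (\<lambda>x. B x t - B x s)"
    and second_moment: "(\<integral>x. (B x t - B x s)\<^sup>2 \<partial>P) = \<bar>t - s\<bar>"
    and fourth_moment: "(\<integral>\<^sup>+x. ennreal ((B x t - B x s) ^ 4) \<partial>P) \<le> ennreal (3 * (t - s)\<^sup>2)"

lemma distributed_normal_even_moment: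
  assumes X: "distributed P lborel X (\<lambda>y. ennreal (normal_density 0 \<sigma> y))" and "0 < \<sigma>"
  shows "(\<integral>\<^sup>+x. ennreal (X x ^ (2 * k)) \<partial>P) = ennreal (fact (2 * k) / ((2 / \<sigma>\<^sup>2) ^ k * fact k))"
proof -
  note moment = normal_moment_even[OF \<open>0 < \<sigma>\<close>, of 0 k, simplified]
  have "(\<integral>\<^sup>+x. ennreal (X x ^ (2 * k)) \<partial>P)
      = (\<integral>\<^sup>+y. ennreal (normal_density 0 \<sigma> y) * ennreal (y ^ (2 * k)) \<partial>lborel)"
    by (rule distributed_nn_integral[OF X, symmetric]) simp
  also have "\<dots> = (\<integral>\<^sup>+y. ennreal (normal_density 0 \<sigma> y * y ^ (2 * k)) \<partial>lborel)"
    by (simp add: ennreal_mult')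
  also have "\<dots> = ennreal (\<integral>y. normal_density 0 \<sigma> y * y ^ (2 * k) \<partial>lborel)"
    using moment by (intro nn_integral_eq_integral) (auto simp: has_bochner_integral_iff)
  also have "(\<integral>y. normal_density 0 \<sigma> y * y ^ (2 * k) \<partial>lborel) = fact (2 * k) / ((2 / \<sigma>\<^sup>2) ^ k * fact k)"
    using moment by (rule has_bochner_integral_integral_eq)
  finally show ?thesis .
qed

lemma brownian_moments_if_two_sided_brownian_motion:
  assumes "prob_space P" and B: "two_sided_brownian_motion P B"
    and meas [measurable]: "B \<in> measurable P path_space"
  shows "brownian_moments P B"
proof -
  interpret prob_space P by fact
  have moment: "(\<integral>\<^sup>+x. ennreal ((B x t - B x s) ^ (2 * k)) \<partial>P)
      = ennreal (fact (2 * k) / (2 ^ k * fact k) * \<bar>t - s\<bar> ^ k)" if "0 < k" for s t k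
  proof -
    have less: "(\<integral>\<^sup>+x. ennreal ((B x t - B x s) ^ (2 * k)) \<partial>P)
      = ennreal (fact (2 * k) / (2 ^ k * fact k) * \<bar>t - s\<bar> ^ k)" if "s < t" for s t
    proof -
      have "distributed P lborel (\<lambda>x. B x t - B x s)
          (\<lambda>y. ennreal (normal_density 0 (sqrt (t - s)) y))"
        using B that by (simp add: two_sided_brownian_motion_def)
      from distributed_normal_even_moment[OF this, of k] that show ?thesis
        by (simp add: power_divide)
    qed
    show ?thesis
    \<comment> \<open>The law of an increment is given for \<open>s < t\<close>; the reverse order
      follows because the power is even.\<close>
    proof (cases s t rule: linorder_cases)
      case greater
      have "(B x t - B x s) ^ (2 * k) = (B x s - B x t) ^ (2 * k)" for x
        using power_minus_Bit0 power2_commute[of "B x t" "B x s"] by (simp add: power_mult)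
      then show ?thesis
        using less[OF greater] by (simp add: abs_minus_commute)
    qed (use less \<open>0 < k\<close> in \<open>auto simp: zero_power\<close>)
  qed
  have comp: "(\<lambda>x. B x t) \<in> borel_measurable P" for t
    by measurable
  have second: "(\<integral>\<^sup>+x. ennreal ((B x t - B x s)\<^sup>2) \<partial>P) = ennreal \<bar>t - s\<bar>" for s t
    using moment[of 1 t s] by simp
  show ?thesis
  proof
    show "continuous_on UNIV (B x)" if "x \<in> space P" for x
      using B that by (simp add: two_sided_brownian_motion_def)
    show "square_integrable P (\<lambda>x. B x t - B x s)" for s t
      using comp by (intro square_integrable_if_nn_integral_le(1)[OF _ second[THEN eq_refl]]) auto
    show "(\<integral>x. (B x t - B x s)\<^sup>2 \<partial>P) = \<bar>t - s\<bar>" for s t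
      using comp by (subst integral_eq_nn_integral) (auto simp: second)
    show "(\<integral>\<^sup>+x. ennreal ((B x t - B x s) ^ 4) \<partial>P) \<le> ennreal (3 * (t - s)\<^sup>2)" for s t
      using moment[of 2 t s] by (simp add: fact_numeral)
  qed fact
qed

context brownian_moments
begin

text \<open>All paths over \<open>space P\<close> are continuous, so evaluation may be replaced by
  \<open>path_eval\<close>. This joint measurability is what the Fubini arguments require.\<close>

lemma path_measurable [measurable (raw)]:
  assumes [measurable]: "g \<in> measurable M P" "h \<in> borel_measurable M"
  shows "(\<lambda>z. B (g z) (h z)) \<in> borel_measurable M"
proof -
  have "(\<lambda>z. path_eval (B (g z)) (h z)) \<in> borel_measurable M"
    by measurable
  moreover have "path_eval (B (g z)) (h z) = B (g z) (h z)" if "z \<in> space M" for z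
    using measurable_space[OF assms(1) that] by (intro path_eval_eq continuous_path)
  ultimately show ?thesis
    by (simp cong: measurable_cong)
qed

lemma increment_eq_functional:
  "x \<in> space P \<Longrightarrow> a \<le> b \<Longrightarrow> increment \<delta> (B x) a b = increment_functional \<delta> a b (B x)"
  by (simp add: increment_functional_eq continuous_path)

lemma increment_measurable:
  assumes "a \<le> b"
  shows "(\<lambda>x. increment \<delta> (B x) a b) \<in> borel_measurable P"
proof -
  have "(\<lambda>x. increment_functional \<delta> a b (B x)) \<in> borel_measurable P"
    by measurable
  then show ?thesis
    using assms by (simp add: increment_eq_functional cong: measurable_cong)
qed

lemma fourth_moment_scaled:
  assumes "0 < \<delta>"
  shows "(\<integral>\<^sup>+x. ennreal (((B x t - B x s) / \<delta>) ^ 4) \<partial>P) \<le> ennreal (3 * (t - s)\<^sup>2 / \<delta> ^ 4)"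
proof -
  have "(\<integral>\<^sup>+x. ennreal (((B x t - B x s) / \<delta>) ^ 4) \<partial>P)
      = (\<integral>\<^sup>+x. ennreal (1 / \<delta> ^ 4) * ennreal ((B x t - B x s) ^ 4) \<partial>P)"
    by (intro nn_integral_cong) (simp add: power_divide flip: ennreal_mult')
  also have "\<dots> = ennreal (1 / \<delta> ^ 4) * (\<integral>\<^sup>+x. ennreal ((B x t - B x s) ^ 4) \<partial>P)"
    by (rule nn_integral_cmult) measurable
  also have "\<dots> \<le> ennreal (1 / \<delta> ^ 4) * ennreal (3 * (t - s)\<^sup>2)"
    by (intro mult_left_mono fourth_moment) auto
  also have "\<dots> = ennreal (3 * (t - s)\<^sup>2 / \<delta> ^ 4)"
    by (simp flip: ennreal_mult')
  finally show ?thesis .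
qed

text \<open>Each of the two representations of the increment is a difference of two terms with
  fourth moment at most \<open>3 * (min (b - a) \<delta>)^2\<close>, the first if
  \<open>b - a \<le> \<delta>\<close> and the second otherwise. The constant is
  \<open>8 * 3 + 8 * 3\<close>.\<close>

lemma increment_fourth_moment:
  assumes "0 \<le> a" "a \<le> b" "0 < \<delta>"
  shows "(\<integral>\<^sup>+x. ennreal (increment \<delta> (B x) a b ^ 4) \<partial>P) \<le> ennreal (48 * (min (b - a) \<delta>)\<^sup>2)"
proof (cases "b - a \<le> \<delta>")
  case True
  have "(\<integral>\<^sup>+x. ennreal ((\<integral>r. (B x (\<delta> + r) - B x r) / \<delta> \<partial>lborel_on a b) ^ 4) \<partial>P)
      \<le> ennreal (measure (lborel_on a b) (space (lborel_on a b)) ^ 4 * (3 * \<delta>\<^sup>2 / \<delta> ^ 4))"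
  proof (rule nn_integral_power_integral_le[OF finite_measure_axioms finite_measure_lborel_on])
    show "AE r in lborel_on a b.
        (\<integral>\<^sup>+x. ennreal (((B x (\<delta> + r) - B x r) / \<delta>) ^ 4) \<partial>P) \<le> ennreal (3 * \<delta>\<^sup>2 / \<delta> ^ 4)"
      using fourth_moment_scaled[OF \<open>0 < \<delta>\<close>, of "\<delta> + r" r for r] by auto
  qed (use \<open>0 < \<delta>\<close> in auto)
  also have "\<dots> \<le> ennreal (3 * (b - a)\<^sup>2)"
  \<comment> \<open>The left side is \<open>3 * (b - a)^4 / \<delta>^2\<close>, and two of the
    factors \<open>b - a\<close> are bounded by \<open>\<delta>\<close>.\<close>
  proof (rule ennreal_leI)
    have "(b - a)\<^sup>2 * (b - a)\<^sup>2 * (3 * \<delta>\<^sup>2 / \<delta> ^ 4) \<le> (b - a)\<^sup>2 * \<delta>\<^sup>2 * (3 * \<delta>\<^sup>2 / \<delta> ^ 4)"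
      using assms True by (intro mult_right_mono mult_left_mono power_mono) auto
    also have "\<dots> = 3 * (b - a)\<^sup>2"
      using \<open>0 < \<delta>\<close> by (simp add: field_simps eval_nat_numeral)
    finally show "measure (lborel_on a b) (space (lborel_on a b)) ^ 4 * (3 * \<delta>\<^sup>2 / \<delta> ^ 4) \<le> 3 * (b - a)\<^sup>2"
      unfolding measure_lborel_on[OF \<open>a \<le> b\<close>] by (simp flip: power_add)
  qed
  finally have drift: "(\<integral>\<^sup>+x. ennreal ((\<integral>r. (B x (\<delta> + r) - B x r) / \<delta> \<partial>lborel_on a b) ^ 4) \<partial>P)
      \<le> ennreal (3 * (b - a)\<^sup>2)" .
  have "(\<integral>\<^sup>+x. ennreal (increment \<delta> (B x) a b ^ 4) \<partial>P)
      = (\<integral>\<^sup>+x. ennreal (((\<integral>r. (B x (\<delta> + r) - B x r) / \<delta> \<partial>lborel_on a b) - (B x b - B x a)) ^ 4) \<partial>P)"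
    using \<open>a \<le> b\<close> by (intro nn_integral_cong) (simp add: increment_eq continuous_path)
  also have "\<dots> \<le> ennreal (8 * (3 * (b - a)\<^sup>2) + 8 * (3 * (b - a)\<^sup>2))"
  proof (rule nn_integral_power4_diff_le[OF _ _ drift fourth_moment])
    interpret N: finite_measure "lborel_on a b" by simp
    show "(\<lambda>x. \<integral>r. (B x (\<delta> + r) - B x r) / \<delta> \<partial>lborel_on a b) \<in> borel_measurable P"
      by measurable
  qed auto
  finally show ?thesis
    using True by (simp add: min_def)
next
  case False
  have avg: "(\<integral>\<^sup>+x. ennreal ((\<integral>r. (B x r - B x t) / \<delta> \<partial>lborel_on t (t + \<delta>)) ^ 4) \<partial>P) \<le> ennreal (3 * \<delta>\<^sup>2)" for t
  proof -
    have "(\<integral>\<^sup>+x. ennreal ((\<integral>r. (B x r - B x t) / \<delta> \<partial>lborel_on t (t + \<delta>)) ^ 4) \<partial>P)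
      \<le> ennreal (measure (lborel_on t (t + \<delta>)) (space (lborel_on t (t + \<delta>))) ^ 4 * (3 * \<delta>\<^sup>2 / \<delta> ^ 4))"
    proof (rule nn_integral_power_integral_le[OF finite_measure_axioms finite_measure_lborel_on])
      show "AE r in lborel_on t (t + \<delta>).
          (\<integral>\<^sup>+x. ennreal (((B x r - B x t) / \<delta>) ^ 4) \<partial>P) \<le> ennreal (3 * \<delta>\<^sup>2 / \<delta> ^ 4)"
      proof (rule AE_I2)
        fix r assume "r \<in> space (lborel_on t (t + \<delta>))"
        then have "(r - t)\<^sup>2 \<le> \<delta>\<^sup>2"
          by (intro power_mono) (auto simp: space_restrict_space)
        then have "3 * (r - t)\<^sup>2 / \<delta> ^ 4 \<le> 3 * \<delta>\<^sup>2 / \<delta> ^ 4"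
          by (intro divide_right_mono) auto
        with fourth_moment_scaled[OF \<open>0 < \<delta>\<close>, of r t]
        show "(\<integral>\<^sup>+x. ennreal (((B x r - B x t) / \<delta>) ^ 4) \<partial>P) \<le> ennreal (3 * \<delta>\<^sup>2 / \<delta> ^ 4)"
          by (meson ennreal_leI order_trans)
      qed
    qed (use \<open>0 < \<delta>\<close> in auto)
    then show ?thesis
      using \<open>0 < \<delta>\<close> unfolding measure_lborel_on[of t "t + \<delta>", simplified, OF less_imp_le[OF \<open>0 < \<delta>\<close>]]
      by (simp add: measure_restrict_space space_restrict_space)
  qed
  have "(\<integral>\<^sup>+x. ennreal (increment \<delta> (B x) a b ^ 4) \<partial>P)
      = (\<integral>\<^sup>+x. ennreal (((\<integral>r. (B x r - B x b) / \<delta> \<partial>lborel_on b (b + \<delta>))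
        - (\<integral>r. (B x r - B x a) / \<delta> \<partial>lborel_on a (a + \<delta>))) ^ 4) \<partial>P)"
    using assms by (intro nn_integral_cong) (simp add: increment_eq_moving_average continuous_path)
  also have "\<dots> \<le> ennreal (8 * (3 * \<delta>\<^sup>2) + 8 * (3 * \<delta>\<^sup>2))"
  proof (rule nn_integral_power4_diff_le[OF _ _ avg avg])
    interpret Na: finite_measure "lborel_on a (a + \<delta>)" by simp
    interpret Nb: finite_measure "lborel_on b (b + \<delta>)" by simp
    show "(\<lambda>x. \<integral>r. (B x r - B x b) / \<delta> \<partial>lborel_on b (b + \<delta>)) \<in> borel_measurable P"
      "(\<lambda>x. \<integral>r. (B x r - B x a) / \<delta> \<partial>lborel_on a (a + \<delta>)) \<in> borel_measurable P"
      by measurable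
  qed auto
  finally show ?thesis
    using False by (simp add: min_def)
qed

lemma increment_square_integrable:
  assumes "0 \<le> a" "a \<le> b" "0 < \<delta>"
  shows "square_integrable P (\<lambda>x. (increment \<delta> (B x) a b)\<^sup>2)"
    and "(\<integral>x. ((increment \<delta> (B x) a b)\<^sup>2)\<^sup>2 \<partial>P) \<le> 48 * (min (b - a) \<delta>)\<^sup>2"
    and "square_integrable P (\<lambda>x. increment \<delta> (B x) a b)"
    and "(\<integral>x. (increment \<delta> (B x) a b)\<^sup>2 \<partial>P) \<le> 25 * min (b - a) \<delta>"
proof -
  note [measurable] = increment_measurable[OF \<open>a \<le> b\<close>]
  have "(\<integral>\<^sup>+x. ennreal (((increment \<delta> (B x) a b)\<^sup>2)\<^sup>2) \<partial>P) \<le> ennreal (48 * (min (b - a) \<delta>)\<^sup>2)"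
    using increment_fourth_moment[OF assms] by simp
  note * = square_integrable_if_nn_integral_le[OF _ this]
  show sq: "square_integrable P (\<lambda>x. (increment \<delta> (B x) a b)\<^sup>2)"
    and le: "(\<integral>x. ((increment \<delta> (B x) a b)\<^sup>2)\<^sup>2 \<partial>P) \<le> 48 * (min (b - a) \<delta>)\<^sup>2"
    by (rule *; simp)+
  show sq1: "square_integrable P (\<lambda>x. increment \<delta> (B x) a b)"
    by (rule square_integrable_if_square[OF finite_measure_axioms _ sq]) measurable
  show "(\<integral>x. (increment \<delta> (B x) a b)\<^sup>2 \<partial>P) \<le> 25 * min (b - a) \<delta>"
  proof (cases "a = b")
    case True
    then show ?thesis using \<open>0 < \<delta>\<close> by (simp add: increment_def)
  next
    case False
    \<comment> \<open>The second moment is recovered from the fourth by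
      \<open>y \<le> (y^2 / c + c) / 2\<close>; with \<open>y^2\<close> of mean at most
      \<open>48 * c^2\<close> this gives \<open>49 / 2 * c\<close>. Dividing by \<open>c\<close> is
      the reason for treating \<open>a = b\<close> separately.\<close>
    define c where "c = min (b - a) \<delta>"
    have c: "0 < c" using assms False by (simp add: c_def)
    have "(\<integral>x. (increment \<delta> (B x) a b)\<^sup>2 \<partial>P) \<le> (\<integral>x. (((increment \<delta> (B x) a b)\<^sup>2)\<^sup>2 / c + c) / 2 \<partial>P)"
    proof (rule integral_mono)
      fix x
      define y where "y = (increment \<delta> (B x) a b)\<^sup>2"
      have "0 \<le> (y - c)\<^sup>2 / c" using c by simp
      also have "\<dots> = y\<^sup>2 / c + c - 2 * y"
        using c by (simp add: power2_diff field_simps power2_eq_square)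
      finally show "(increment \<delta> (B x) a b)\<^sup>2 \<le> (((increment \<delta> (B x) a b)\<^sup>2)\<^sup>2 / c + c) / 2"
        unfolding y_def by simp
    qed (use sq sq1 in \<open>auto simp: square_integrable_def\<close>)
    also have "\<dots> = ((\<integral>x. ((increment \<delta> (B x) a b)\<^sup>2)\<^sup>2 \<partial>P) / c + c) / 2"
      using sq by (simp add: square_integrable_def prob_space)
    also have "\<dots> \<le> (48 * c\<^sup>2 / c + c) / 2"
      using le c by (intro divide_right_mono add_right_mono) (auto simp: c_def)
    also have "\<dots> \<le> 25 * c"
      using c by (simp add: power2_eq_square)
    finally show ?thesis by (simp add: c_def)
  qed
qed

end

subsection \<open>Sums with independent integrands\<close>

text \<open>Polarization: the product of two increments is half a signed sum of four squared
  increments.\<close>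

lemma (in brownian_moments) path_covariance:
  "(\<integral>x. (B x b - B x a) * (B x d - B x c) \<partial>P) = (\<bar>b - c\<bar> + \<bar>a - d\<bar> - \<bar>b - d\<bar> - \<bar>a - c\<bar>) / 2"
proof -
  have sq: "integrable P (\<lambda>x. (B x t - B x s)\<^sup>2)" for s t
    using square_integrable_diff_path by (simp add: square_integrable_def)
  have "(\<integral>x. (B x b - B x a) * (B x d - B x c) \<partial>P)
      = (\<integral>x. ((B x b - B x c)\<^sup>2 + (B x a - B x d)\<^sup>2 - (B x b - B x d)\<^sup>2 - (B x a - B x c)\<^sup>2) / 2 \<partial>P)"
    by (intro Bochner_Integration.integral_cong) (auto simp: power2_eq_square algebra_simps)
  also have "\<dots> = (\<bar>b - c\<bar> + \<bar>a - d\<bar> - \<bar>b - d\<bar> - \<bar>a - c\<bar>) / 2"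
    by (simp add: sq second_moment)
  finally show ?thesis .
qed

lemma integral_lborel_on:
  fixes f :: "real \<Rightarrow> real"
  shows "(\<integral>r. f r \<partial>lborel_on a b) = (\<integral>r. indicator {a..b} r * f r \<partial>lborel)"
  by (simp add: integral_restrict_space)

text \<open>The overlap length of two intervals, in the form in which \<open>path_covariance\<close>
  produces it. Together the two lemmas are the Ito isometry on indicators.\<close>

lemma integral_indicator_Icc_mult:
  fixes a b c d s t :: real
  assumes "s \<le> a" "a \<le> b" "b \<le> t" "s \<le> c" "c \<le> d" "d \<le> t"
  shows "(\<integral>r. indicator {a..b} r * indicator {c..d} r \<partial>lborel_on s t)
    = (\<bar>b - c\<bar> + \<bar>a - d\<bar> - \<bar>b - d\<bar> - \<bar>a - c\<bar>) / 2"
proof -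
  have "(\<integral>r. indicator {a..b} r * indicator {c..d} r \<partial>lborel_on s t)
      = (\<integral>r. (indicator {max a c..min b d} r :: real) \<partial>lborel)"
    unfolding integral_lborel_on using assms by (intro Bochner_Integration.integral_cong) (auto simp: indicator_def)
  also have "\<dots> = (\<bar>b - c\<bar> + \<bar>a - d\<bar> - \<bar>b - d\<bar> - \<bar>a - c\<bar>) / 2"
    using assms by (auto simp: max_def min_def measure_def emeasure_lborel_Icc_eq)
  finally show ?thesis .
qed

locale independent_brownian_moments =
  U: brownian_moments P U + V: brownian_moments P V
  for P :: "'a measure" and U V :: "'a \<Rightarrow> real \<Rightarrow> real" +
  assumes indep: "U.indep_var path_space U path_space V"
begin

lemma product_expectation:
  fixes F G :: "(real \<Rightarrow> real) \<Rightarrow> real"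
  assumes "F \<in> borel_measurable path_space" "G \<in> borel_measurable path_space"
    and "integrable P (\<lambda>x. F (U x))" "integrable P (\<lambda>x. G (V x))"
  shows "integrable P (\<lambda>x. F (U x) * G (V x))"
    and "(\<integral>x. F (U x) * G (V x) \<partial>P) = (\<integral>x. F (U x) \<partial>P) * (\<integral>x. G (V x) \<partial>P)"
proof -
  have "U.indep_var borel (F \<circ> U) borel (G \<circ> V)"
    using indep assms(1,2) by (rule U.indep_var_compose)
  then have ind: "U.indep_var borel (\<lambda>x. F (U x)) borel (\<lambda>x. G (V x))"
    by (simp add: comp_def)
  show "integrable P (\<lambda>x. F (U x) * G (V x))"
    by (rule U.indep_var_integrable[OF ind assms(3,4)])
  show "(\<integral>x. F (U x) * G (V x) \<partial>P) = (\<integral>x. F (U x) \<partial>P) * (\<integral>x. G (V x) \<partial>P)"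
    by (rule U.indep_var_lebesgue_integral[OF ind assms(3,4)])
qed

text \<open>Independence is applied to the squares of the two factors; products of dependent square
  integrable functions are in general only integrable.\<close>

lemma product_square_integrable:
  fixes F G :: "(real \<Rightarrow> real) \<Rightarrow> real"
  assumes [measurable]: "F \<in> borel_measurable path_space" "G \<in> borel_measurable path_space"
    and "square_integrable P (\<lambda>x. F (U x))" "square_integrable P (\<lambda>x. G (V x))"
  shows "square_integrable P (\<lambda>x. F (U x) * G (V x))"
    and "(\<integral>x. (F (U x) * G (V x))\<^sup>2 \<partial>P) = (\<integral>x. (F (U x))\<^sup>2 \<partial>P) * (\<integral>x. (G (V x))\<^sup>2 \<partial>P)"
proof -
  have "integrable P (\<lambda>x. (F (U x))\<^sup>2)" "integrable P (\<lambda>x. (G (V x))\<^sup>2)"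
    using assms(3,4) by (auto simp: square_integrable_def)
  note * = product_expectation[of "\<lambda>f. (F f)\<^sup>2" "\<lambda>f. (G f)\<^sup>2", OF _ _ this]
  show "(\<integral>x. (F (U x) * G (V x))\<^sup>2 \<partial>P) = (\<integral>x. (F (U x))\<^sup>2 \<partial>P) * (\<integral>x. (G (V x))\<^sup>2 \<partial>P)"
    using *(2) by (simp add: power_mult_distrib)
  show "square_integrable P (\<lambda>x. F (U x) * G (V x))"
    using *(1) by (simp add: power_mult_distrib square_integrable_def)
qed

lemma product_covariance:
  fixes F F' G G' :: "(real \<Rightarrow> real) \<Rightarrow> real"
  assumes [measurable]: "F \<in> borel_measurable path_space" "F' \<in> borel_measurable path_space"
      "G \<in> borel_measurable path_space" "G' \<in> borel_measurable path_space"
    and "square_integrable P (\<lambda>x. F (U x))" "square_integrable P (\<lambda>x. F' (U x))"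
      "square_integrable P (\<lambda>x. G (V x))" "square_integrable P (\<lambda>x. G' (V x))"
  shows "(\<integral>x. (F (U x) * G (V x)) * (F' (U x) * G' (V x)) \<partial>P)
    = (\<integral>x. F (U x) * F' (U x) \<partial>P) * (\<integral>x. G (V x) * G' (V x) \<partial>P)"
  using product_expectation(2)[of "\<lambda>f. F f * F' f" "\<lambda>f. G f * G' f"]
    square_integrable_mult_integrable[OF assms(5,6)] square_integrable_mult_integrable[OF assms(7,8)]
  by (simp add: ac_simps)

text \<open>
  With \<open>\<Phi> a = (\<Sum>n. \<zeta> n (U) 1\<^bsub>[u n, v n]\<^esub> a)\<close>, the sum is \<open>\<integral>\<Phi> dX\<close>, where \<open>dX\<close> is the difference
  of \<open>g(a) da\<close> with \<open>g(a) = (V(\<delta> + a) - V(a)) / \<delta>\<close> and of the Brownian differential. The second part is an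
  isometry. In the first part \<open>g\<close> has covariance at most \<open>1 / \<delta>\<close>, which vanishes at distance \<open>\<delta>\<close>;
  integrated over the second time variable, this leaves a factor 2.
\<close>

lemma integral_square_step_sum_le:
  fixes \<zeta> :: "'n \<Rightarrow> (real \<Rightarrow> real) \<Rightarrow> real" and u v :: "'n \<Rightarrow> real"
  assumes \<delta>: "0 < \<delta>" and st: "s \<le> t"
    and meas [measurable]: "\<And>n. n \<in> I \<Longrightarrow> \<zeta> n \<in> borel_measurable path_space"
    and \<zeta>: "\<And>n. n \<in> I \<Longrightarrow> square_integrable P (\<lambda>x. \<zeta> n (U x))"
    and uv: "\<And>n. n \<in> I \<Longrightarrow> s \<le> u n \<and> u n \<le> v n \<and> v n \<le> t"
    and W: "AE a in lborel_on s t. 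
      (\<integral>x. (\<Sum>n\<in>I. \<zeta> n (U x) * indicator {u n..v n} a)\<^sup>2 \<partial>P) \<le> W"
    and "0 \<le> W"
  shows "(\<integral>x. (\<Sum>n\<in>I. \<zeta> n (U x) * increment \<delta> (V x) (u n) (v n))\<^sup>2 \<partial>P) \<le> 6 * (t - s) * W"
proof -
  define N where "N = lborel_on s t"
  have fin_N: "finite_measure N" by (simp add: N_def)
  interpret N: finite_measure N by (rule fin_N)
  have mass: "measure N (space N) = t - s"
    unfolding N_def by (rule measure_lborel_on[OF st])
  have N_meas [measurable]: "snd \<in> borel_measurable (P \<Otimes>\<^sub>M N)"
    unfolding N_def by measurable
  have ind_meas [measurable]: "(\<lambda>r. indicator {a..b} r :: real) \<in> borel_measurable N" for a b
    unfolding N_def by (intro measurable_restrict_space1) simp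

  define \<phi> where "\<phi> a f = (\<Sum>n\<in>I. \<zeta> n f * indicator {u n..v n} a)" for a f
  have \<phi>_meas [measurable]: "\<phi> a \<in> borel_measurable path_space" for a
    unfolding \<phi>_def by measurable
  have \<phi>_si: "square_integrable P (\<lambda>x. \<phi> a (U x))" for a
    unfolding \<phi>_def
    by (intro square_integrable_sum) (subst mult.commute, intro square_integrable_cmult \<zeta>)
  define \<gamma> where "\<gamma> a f = (f (\<delta> + a) - f a) / \<delta>" for a :: real and f :: "real \<Rightarrow> real"
  have \<gamma>_meas [measurable]: "\<gamma> a \<in> borel_measurable path_space" for a
    unfolding \<gamma>_def by measurable
  have \<gamma>_si: "square_integrable P (\<lambda>x. \<gamma> a (V x))" for a
    using square_integrable_cmult[OF V.square_integrable_diff_path, of "1 / \<delta>" "\<delta> + a" a]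
    by (simp add: \<gamma>_def)
  have \<gamma>_cov: "(\<integral>x. \<gamma> a (V x) * \<gamma> b (V x) \<partial>P) = (\<bar>\<delta> + a - b\<bar> + \<bar>a - (\<delta> + b)\<bar> - 2 * \<bar>a - b\<bar>) / (2 * \<delta>\<^sup>2)" for a b
  proof -
    have "(\<integral>x. \<gamma> a (V x) * \<gamma> b (V x) \<partial>P)
        = (\<integral>x. (V x (\<delta> + a) - V x a) * (V x (\<delta> + b) - V x b) / \<delta>\<^sup>2 \<partial>P)"
      by (simp add: \<gamma>_def power2_eq_square)
    then show ?thesis
      by (simp add: V.path_covariance)
  qed
  have \<gamma>_cov_le: "\<bar>\<integral>x. \<gamma> a (V x) * \<gamma> b (V x) \<partial>P\<bar> \<le> 1 / \<delta> * indicator {a - \<delta>..a + \<delta>} b" for a b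
  proof -
    define h where "h = \<bar>\<delta> + a - b\<bar> + \<bar>a - (\<delta> + b)\<bar> - 2 * \<bar>a - b\<bar>"
    \<comment> \<open>\<open>h\<close> is twice the overlap length of the windows of length
      \<open>\<delta>\<close> starting at \<open>a\<close> and at \<open>b\<close>.\<close>
    have "0 \<le> h" "h \<le> 2 * \<delta> * indicator {a - \<delta>..a + \<delta>} b"
      using \<delta> by (auto simp: h_def indicator_def split: abs_split)
    then have "h / (2 * \<delta>\<^sup>2) \<le> 2 * \<delta> * indicator {a - \<delta>..a + \<delta>} b / (2 * \<delta>\<^sup>2)"
      by (intro divide_right_mono) auto
    then show ?thesis
      using \<delta> \<open>0 \<le> h\<close> by (simp add: \<gamma>_cov power2_eq_square flip: h_def)
  qed

  define drift where "drift = (\<lambda>x. \<integral>a. \<phi> a (U x) * \<gamma> a (V x) \<partial>N)"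
  define noise where "noise = (\<lambda>x. \<Sum>n\<in>I. \<zeta> n (U x) * (V x (v n) - V x (u n)))"

  have W': "AE a in N. (\<integral>x. (\<phi> a (U x))\<^sup>2 \<partial>P) \<le> W"
    using W unfolding \<phi>_def N_def .

  have noise_si: "square_integrable P noise"
    unfolding noise_def
    by (intro square_integrable_sum product_square_integrable(1)[where G="\<lambda>f. f (v n) - f (u n)" for n]
        \<zeta> V.square_integrable_diff_path) auto
  have noise_le: "(\<integral>x. (noise x)\<^sup>2 \<partial>P) \<le> (t - s) * W"
  proof -
    have int\<zeta>: "integrable P (\<lambda>x. \<zeta> n (U x) * \<zeta> m (U x))" if "n \<in> I" "m \<in> I" for n m
      using that by (intro square_integrable_mult_integrable \<zeta>)
    have "(\<integral>x. (noise x)\<^sup>2 \<partial>P)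
        = (\<integral>x. (\<Sum>n\<in>I. \<Sum>m\<in>I. (\<zeta> n (U x) * (V x (v n) - V x (u n))) * (\<zeta> m (U x) * (V x (v m) - V x (u m)))) \<partial>P)"
      by (simp add: noise_def power2_eq_square sum_product)
    also have "\<dots> = (\<Sum>n\<in>I. \<Sum>m\<in>I. \<integral>x. (\<zeta> n (U x) * (V x (v n) - V x (u n))) * (\<zeta> m (U x) * (V x (v m) - V x (u m))) \<partial>P)"
    proof -
      have "integrable P (\<lambda>x. (\<zeta> n (U x) * (V x (v n) - V x (u n))) * (\<zeta> m (U x) * (V x (v m) - V x (u m))))"
        if "n \<in> I" "m \<in> I" for n m
        using that
        by (intro square_integrable_mult_integrable
            product_square_integrable(1)[where G="\<lambda>f. f (v n) - f (u n)" for n] \<zeta> V.square_integrable_diff_path) auto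
      then show ?thesis by simp
    qed
    \<comment> \<open>Independence splits off the covariance of the Brownian increments, which is an
      overlap length. Writing it as an integral over \<open>a\<close> lets the double sum reassemble
      to the second moment of \<open>\<phi> a\<close>.\<close>
    also have "\<dots> = (\<Sum>n\<in>I. \<Sum>m\<in>I. \<integral>a. (\<integral>x. \<zeta> n (U x) * \<zeta> m (U x) \<partial>P) * (indicator {u n..v n} a * indicator {u m..v m} a) \<partial>N)"
    proof (intro sum.cong refl)
      fix n m assume nm: "n \<in> I" "m \<in> I"
      have "(\<integral>x. (\<zeta> n (U x) * (V x (v n) - V x (u n))) * (\<zeta> m (U x) * (V x (v m) - V x (u m))) \<partial>P)
          = (\<integral>x. \<zeta> n (U x) * \<zeta> m (U x) \<partial>P) * (\<integral>x. (V x (v n) - V x (u n)) * (V x (v m) - V x (u m)) \<partial>P)"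
        using nm
        by (intro product_covariance[where G="\<lambda>f. f (v n) - f (u n)" and G'="\<lambda>f. f (v m) - f (u m)"]
            \<zeta> V.square_integrable_diff_path) auto
      also have "\<dots> = (\<integral>a. (\<integral>x. \<zeta> n (U x) * \<zeta> m (U x) \<partial>P) * (indicator {u n..v n} a * indicator {u m..v m} a) \<partial>N)"
        using uv[OF nm(1)] uv[OF nm(2)]
        by (simp add: N_def V.path_covariance integral_indicator_Icc_mult)
      finally show "(\<integral>x. (\<zeta> n (U x) * (V x (v n) - V x (u n))) * (\<zeta> m (U x) * (V x (v m) - V x (u m))) \<partial>P) = \<dots>" .
    qed
    also have "\<dots> = (\<integral>a. (\<Sum>n\<in>I. \<Sum>m\<in>I. (\<integral>x. \<zeta> n (U x) * \<zeta> m (U x) \<partial>P) * (indicator {u n..v n} a * indicator {u m..v m} a)) \<partial>N)"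
    proof -
      have "integrable N (\<lambda>a. (\<integral>x. \<zeta> n (U x) * \<zeta> m (U x) \<partial>P) * (indicator {u n..v n} a * indicator {u m..v m} a))" for n m
      proof (intro integrable_mult_right N.integrable_const_bound[of _ 1])
        show "AE a in N. norm (indicator {u n..v n} a * indicator {u m..v m} a :: real) \<le> 1"
          by (simp add: indicator_def)
      qed measurable
      then show ?thesis by simp
    qed
    also have "\<dots> = (\<integral>a. (\<integral>x. (\<phi> a (U x))\<^sup>2 \<partial>P) \<partial>N)"
    proof (intro Bochner_Integration.integral_cong refl)
      fix a
      have "(\<integral>x. (\<phi> a (U x))\<^sup>2 \<partial>P)
          = (\<integral>x. (\<Sum>n\<in>I. \<Sum>m\<in>I. \<zeta> n (U x) * \<zeta> m (U x) * (indicator {u n..v n} a * indicator {u m..v m} a)) \<partial>P)"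
        by (simp add: \<phi>_def power2_eq_square sum_product ac_simps)
      also have "\<dots> = (\<Sum>n\<in>I. \<Sum>m\<in>I. (\<integral>x. \<zeta> n (U x) * \<zeta> m (U x) \<partial>P) * (indicator {u n..v n} a * indicator {u m..v m} a))"
        using int\<zeta> by simp
      finally show "(\<Sum>n\<in>I. \<Sum>m\<in>I. (\<integral>x. \<zeta> n (U x) * \<zeta> m (U x) \<partial>P) * (indicator {u n..v n} a * indicator {u m..v m} a))
          = (\<integral>x. (\<phi> a (U x))\<^sup>2 \<partial>P)" by simp
    qed
    also have "\<dots> \<le> (\<integral>a. W \<partial>N)"
    \<comment> \<open>In the non-integrable case the Bochner integral is 0 by convention, and
      \<open>0 \<le> W\<close> is enough.\<close>
    proof (cases "integrable N (\<lambda>a. \<integral>x. (\<phi> a (U x))\<^sup>2 \<partial>P)")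
      case True
      then show ?thesis using W' by (intro integral_mono_AE) auto
    next
      case False
      then show ?thesis using \<open>0 \<le> W\<close> by (simp add: not_integrable_integral_eq)
    qed
    finally show ?thesis by (simp add: mass)
  qed

  have \<Psi>_meas: "(\<lambda>(x, a). \<phi> a (U x) * \<gamma> a (V x)) \<in> borel_measurable (P \<Otimes>\<^sub>M N)"
    unfolding \<phi>_def \<gamma>_def split_beta' by measurable
  \<comment> \<open>The bound \<open>W / \<delta>\<close> degenerates as \<open>\<delta>\<close>
    tends to 0 and serves for integrability; the uniform estimate comes from the row integrals of
    the covariance.\<close>
  have \<Psi>_si: "AE a in N. square_integrable P (\<lambda>x. \<phi> a (U x) * \<gamma> a (V x))
      \<and> (\<integral>x. (\<phi> a (U x) * \<gamma> a (V x))\<^sup>2 \<partial>P) \<le> W / \<delta>"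
    using W'
  proof eventually_elim
    case (elim a)
    note si = product_square_integrable[OF \<phi>_meas \<gamma>_meas \<phi>_si \<gamma>_si, of a a]
    have "(\<integral>x. (\<gamma> a (V x))\<^sup>2 \<partial>P) \<le> 1 / \<delta>"
      using \<gamma>_cov_le[of a a] \<delta> by (simp add: power2_eq_square)
    then have "(\<integral>x. (\<phi> a (U x))\<^sup>2 \<partial>P) * (\<integral>x. (\<gamma> a (V x))\<^sup>2 \<partial>P) \<le> W * (1 / \<delta>)"
      using elim \<open>0 \<le> W\<close> by (intro mult_mono) auto
    with si show ?case by simp
  qed
  \<comment> \<open>The covariance factorises into one of \<open>\<phi>\<close>, at most
    \<open>W\<close> in absolute value, and one of \<open>\<gamma>\<close>, at most
    \<open>1 / \<delta>\<close> on a window of length \<open>2 * \<delta>\<close> and zero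
    outside.\<close>
  have "AE a in N. (\<integral>b. (\<integral>x. (\<phi> a (U x) * \<gamma> a (V x)) * (\<phi> b (U x) * \<gamma> b (V x)) \<partial>P) \<partial>N) \<le> 2 * W"
    using W' \<Psi>_si
  proof eventually_elim
    case (elim a)
    note int = integral_mult_integral_eq(1)[OF U.finite_measure_axioms fin_N \<Psi>_meas conjunct1[OF elim(2)] \<Psi>_si]
    have "(\<integral>b. (\<integral>x. (\<phi> a (U x) * \<gamma> a (V x)) * (\<phi> b (U x) * \<gamma> b (V x)) \<partial>P) \<partial>N)
        \<le> (\<integral>b. W / \<delta> * indicator {a - \<delta>..a + \<delta>} b \<partial>N)"
    proof (rule integral_mono_AE[OF int])
      show "integrable N (\<lambda>b. W / \<delta> * indicator {a - \<delta>..a + \<delta>} b)"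
      proof (intro integrable_mult_right N.integrable_const_bound[of _ 1])
        show "AE b in N. norm (indicator {a - \<delta>..a + \<delta>} b :: real) \<le> 1"
          by (simp add: indicator_def)
      qed measurable
      show "AE b in N. (\<integral>x. (\<phi> a (U x) * \<gamma> a (V x)) * (\<phi> b (U x) * \<gamma> b (V x)) \<partial>P)
          \<le> W / \<delta> * indicator {a - \<delta>..a + \<delta>} b"
        using W'
      proof eventually_elim
        case (elim b)
        have "\<bar>\<integral>x. \<phi> a (U x) * \<phi> b (U x) \<partial>P\<bar> \<le> (\<integral>x. \<bar>\<phi> a (U x) * \<phi> b (U x)\<bar> \<partial>P)"
          by (rule integral_abs_bound)
        also have "\<dots> \<le> (\<integral>x. ((\<phi> a (U x))\<^sup>2 + (\<phi> b (U x))\<^sup>2) / 2 \<partial>P)"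
        proof (rule integral_mono)
          show "integrable P (\<lambda>x. \<bar>\<phi> a (U x) * \<phi> b (U x)\<bar>)"
            by (intro integrable_abs square_integrable_mult_integrable \<phi>_si)
          show "integrable P (\<lambda>x. ((\<phi> a (U x))\<^sup>2 + (\<phi> b (U x))\<^sup>2) / 2)"
            using \<phi>_si by (simp add: square_integrable_def)
          fix x
          show "\<bar>\<phi> a (U x) * \<phi> b (U x)\<bar> \<le> ((\<phi> a (U x))\<^sup>2 + (\<phi> b (U x))\<^sup>2) / 2"
            using zero_le_power2[of "\<bar>\<phi> a (U x)\<bar> - \<bar>\<phi> b (U x)\<bar>"]
            by (simp add: power2_diff abs_mult)
        qed
        also have "\<dots> = ((\<integral>x. (\<phi> a (U x))\<^sup>2 \<partial>P) + (\<integral>x. (\<phi> b (U x))\<^sup>2 \<partial>P)) / 2"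
          using \<phi>_si by (simp add: square_integrable_def)
        also have "\<dots> \<le> W"
          using elim \<open>(\<integral>x. (\<phi> a (U x))\<^sup>2 \<partial>P) \<le> W\<close> by simp
        finally have "\<bar>(\<integral>x. \<phi> a (U x) * \<phi> b (U x) \<partial>P) * (\<integral>x. \<gamma> a (V x) * \<gamma> b (V x) \<partial>P)\<bar>
            \<le> W * (1 / \<delta> * indicator {a - \<delta>..a + \<delta>} b)"
          unfolding abs_mult using \<gamma>_cov_le[of a b] \<open>0 \<le> W\<close> by (intro mult_mono) auto
        then show ?case
          using product_covariance[OF \<phi>_meas \<phi>_meas \<gamma>_meas \<gamma>_meas \<phi>_si \<phi>_si \<gamma>_si \<gamma>_si, of a a b b]
          by simp
      qed
    qed
    also have "\<dots> = W / \<delta> * measure N ({a - \<delta>..a + \<delta>} \<inter> space N)"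
      by simp
    also have "\<dots> \<le> W / \<delta> * (2 * \<delta>)"
    proof (rule mult_left_mono)
      have "measure N ({a - \<delta>..a + \<delta>} \<inter> space N) = measure lborel ({a - \<delta>..a + \<delta>} \<inter> {s..t})"
        unfolding N_def by (subst measure_restrict_space) (auto simp: space_restrict_space)
      also have "\<dots> \<le> measure lborel {a - \<delta>..a + \<delta>}"
        by (rule measure_mono_fmeasurable) (auto simp: fmeasurable_def emeasure_lborel_Icc_eq)
      also have "\<dots> = 2 * \<delta>" using \<delta> by simp
      finally show "measure N ({a - \<delta>..a + \<delta>} \<inter> space N) \<le> 2 * \<delta>" .
    qed (use \<open>0 \<le> W\<close> \<delta> in simp)
    finally show ?case using \<delta> by simp
  qed
  from integral_square_integral_le[OF U.finite_measure_axioms fin_N \<Psi>_meas \<Psi>_si _ this] \<open>0 \<le> W\<close> \<delta>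
  have drift_si: "square_integrable P drift" and drift_le: "(\<integral>x. (drift x)\<^sup>2 \<partial>P) \<le> (t - s) * (2 * W)"
    by (simp_all add: drift_def mass)

  have decomposition: "(\<Sum>n\<in>I. \<zeta> n (U x) * increment \<delta> (V x) (u n) (v n)) = drift x + (-1) * noise x"
    if x: "x \<in> space P" for x
  proof -
    have cont: "continuous_on S (\<lambda>a. \<gamma> a (V x))" for S
      unfolding \<gamma>_def using \<delta>
      by (intro continuous_intros continuous_on_compose2[OF V.continuous_path[OF x]]) auto
    have int: "integrable N (\<lambda>a. indicator {u n..v n} a * \<gamma> a (V x))" for n
    proof (rule Bochner_Integration.integrable_bound)
      show \<gamma>_int: "integrable N (\<lambda>a. \<gamma> a (V x))"
        unfolding N_def by (rule integrable_lborel_on[OF cont])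
      show "(\<lambda>a. indicator {u n..v n} a * \<gamma> a (V x)) \<in> borel_measurable N"
        using borel_measurable_integrable[OF \<gamma>_int] by measurable
    qed (simp add: indicator_def)
    have part: "(\<integral>a. indicator {u n..v n} a * \<gamma> a (V x) \<partial>N) = (\<integral>a. \<gamma> a (V x) \<partial>lborel_on (u n) (v n))"
      if "n \<in> I" for n
      unfolding N_def integral_lborel_on
      using uv[OF that] by (intro Bochner_Integration.integral_cong) (auto simp: indicator_def)
    have "drift x = (\<integral>a. (\<Sum>n\<in>I. \<zeta> n (U x) * (indicator {u n..v n} a * \<gamma> a (V x))) \<partial>N)"
      by (simp add: drift_def \<phi>_def sum_distrib_right mult.assoc)
    also have "\<dots> = (\<Sum>n\<in>I. \<zeta> n (U x) * (\<integral>a. \<gamma> a (V x) \<partial>lborel_on (u n) (v n)))"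
      using int by (simp add: part)
    finally show ?thesis
      using uv V.continuous_path[OF x]
      by (simp add: noise_def increment_eq \<gamma>_def right_diff_distrib sum_subtractf)
  qed
  have "(\<integral>x. (\<Sum>n\<in>I. \<zeta> n (U x) * increment \<delta> (V x) (u n) (v n))\<^sup>2 \<partial>P)
      = (\<integral>x. (drift x + (-1) * noise x)\<^sup>2 \<partial>P)"
    by (intro Bochner_Integration.integral_cong refl) (simp only: decomposition)
  also have "\<dots> \<le> 2 * (\<integral>x. (drift x)\<^sup>2 \<partial>P) + 2 * (\<integral>x. ((-1) * noise x)\<^sup>2 \<partial>P)"
    by (intro integral_square_add_le drift_si square_integrable_cmult noise_si)
  \<comment> \<open>Twice the drift bound with factor 2 plus twice the noise bound with factor
    1.\<close>
  also have "\<dots> \<le> 6 * (t - s) * W"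
    using drift_le noise_le by (simp add: algebra_simps)
  finally show ?thesis .
qed

end

subsection \<open>Convergence of the area sums\<close>

lemma division_of_Icc_memberD:
  fixes s t :: real
  assumes "p division_of {s..t}" and "K \<in> p"
  shows "K = {Inf K..Sup K}" and "s \<le> Inf K" and "Inf K \<le> Sup K" and "Sup K \<le> t"
proof -
  from division_ofD(2-4)[OF assms] obtain a b where K: "K \<subseteq> {s..t}" "K \<noteq> {}" "K = {a..b}"
    by (metis box_real(2))
  then have "a \<le> b" by auto
  with K have "Inf K = a" "Sup K = b" by auto
  with K \<open>a \<le> b\<close> show "K = {Inf K..Sup K}" "s \<le> Inf K" "Inf K \<le> Sup K" "Sup K \<le> t"
    by auto
qed

text \<open>Members of a division overlap only in their finitely many end points, so almost every
  \<open>a\<close> lies in exactly one member. A single \<open>K\<close> serves all weights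
  \<open>F\<close>, since the weights will be random while \<open>K\<close> must not be.\<close>

lemma division_of_Icc_AE_sum_indicator:
  fixes s t :: real
  assumes p: "p division_of {s..t}"
  shows "AE a in lborel_on s t. \<exists>K\<in>p. a \<in> K \<and>
    (\<forall>F. (\<Sum>L\<in>p. F L * indicator {Inf L..Sup L} a) = (F K :: real))"
proof -
  define E where "E = Inf ` p \<union> Sup ` p"
  have "finite p" using p by (rule division_of_finite)
  then have "E \<in> null_sets lborel"
    by (intro countable_imp_null_set_lborel countable_finite) (simp add: E_def)
  then have "AE a in lborel. a \<notin> E" by (rule AE_not_in)
  then have "AE a in lborel. a \<in> {s..t} \<longrightarrow> (\<exists>K\<in>p. a \<in> K \<and>
    (\<forall>F. (\<Sum>L\<in>p. F L * indicator {Inf L..Sup L} a) = (F K :: real)))"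
  proof eventually_elim
    case (elim a)
    show ?case
    proof
      assume "a \<in> {s..t}"
      then obtain K where K: "K \<in> p" "a \<in> K"
        using division_ofD(6)[OF p] by blast
      have interior: "a \<in> interior L" if "L \<in> p" "a \<in> L" for L
      proof -
        have "L = {Inf L..Sup L}" using division_of_Icc_memberD(1)[OF p that(1)] .
        then have "interior L = {Inf L<..<Sup L}" by (metis interior_atLeastAtMost_real)
        moreover have "a \<noteq> Inf L" "a \<noteq> Sup L" using elim that(1) by (auto simp: E_def)
        moreover have "Inf L \<le> a" "a \<le> Sup L" using \<open>L = _\<close> that(2) by (metis atLeastAtMost_iff)+
        ultimately show ?thesis by auto
      qed
      have unique: "a \<in> {Inf L..Sup L} \<longleftrightarrow> L = K" if "L \<in> p" for L
        using division_ofD(5)[OF p that K(1)] interior[OF that] interior[OF K] K(2)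
          division_of_Icc_memberD(1)[OF p that] by blast
      have "(\<Sum>L\<in>p. F L * indicator {Inf L..Sup L} a) = F K" for F :: "real set \<Rightarrow> real"
      proof -
        have "(\<Sum>L\<in>p. F L * indicator {Inf L..Sup L} a) = (\<Sum>L\<in>p. if L = K then F L else 0)"
          using unique by (intro sum.cong refl) (auto simp: indicator_def simp del: atLeastAtMost_iff)
        then show ?thesis using K(1) \<open>finite p\<close> by simp
      qed
      then show "\<exists>K\<in>p. a \<in> K \<and> (\<forall>F. (\<Sum>L\<in>p. F L * indicator {Inf L..Sup L} a) = (F K :: real))"
        using K by (intro bexI[of _ K] conjI allI)
    qed
  qed
  then show ?thesis
    by (simp add: AE_restrict_space_iff)
qed

definition fine_divisions :: "real \<Rightarrow> real \<Rightarrow> real \<Rightarrow> real set set set" where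
  "fine_divisions s t \<eta> = {p. p division_of {s..t} \<and> (\<forall>K\<in>p. Sup K - Inf K < \<eta>)}"

text \<open>Cousin's lemma: each member lies in a ball of radius \<open>\<eta> / 3\<close> around
  its tag, so its end points are less than \<open>2 * \<eta> / 3\<close> apart.\<close>

lemma fine_divisions_nonempty:
  assumes "0 < \<eta>"
  shows "fine_divisions s t \<eta> \<noteq> {}"
proof -
  have "gauge (\<lambda>x::real. ball x (\<eta> / 3))" using assms by (intro gauge_ball) simp
  then obtain p where p: "p tagged_division_of {s..t}" "(\<lambda>x. ball x (\<eta> / 3)) fine p"
    by (rule fine_division_exists_real)
  from p(1) have div: "(snd ` p) division_of {s..t}" by (rule division_of_tagged_division)
  have "Sup K - Inf K < \<eta>" if "K \<in> snd ` p" for K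
  proof -
    from that obtain x where x: "(x, K) \<in> p" by auto
    then have "K \<subseteq> ball x (\<eta> / 3)" using p(2) by (auto simp: fine_def)
    moreover have "Inf K \<in> K" "Sup K \<in> K"
      using division_of_Icc_memberD[OF div that] by (metis atLeastAtMost_iff order_refl)+
    ultimately have "dist x (Inf K) < \<eta> / 3" "dist x (Sup K) < \<eta> / 3" by auto
    then show ?thesis unfolding dist_real_def by linarith
  qed
  with div show ?thesis by (auto simp: fine_divisions_def)
qed

text \<open>Version for unordered end points: the left end points of members of two different
  divisions may come in either order.\<close>

lemma (in brownian_moments) increment_second_moment:
  assumes "0 \<le> a" "0 \<le> b" "0 < \<delta>"
  shows "(\<integral>x. (increment \<delta> (B x) a b)\<^sup>2 \<partial>P) \<le> 25 * min \<bar>b - a\<bar> \<delta>"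
proof (cases "a \<le> b")
  case True
  then show ?thesis using increment_square_integrable(4)[of a b \<delta>] assms by simp
next
  case False
  have "(increment \<delta> (B x) a b)\<^sup>2 = (increment \<delta> (B x) b a)\<^sup>2" for x
    by (simp add: increment_def power2_commute)
  then show ?thesis using False increment_square_integrable(4)[of b a \<delta>] assms by simp
qed

context independent_brownian_moments
begin

definition area_sum :: "real \<Rightarrow> real \<Rightarrow> real set set \<Rightarrow> 'a \<Rightarrow> real" where
  "area_sum \<delta> s p x =
     (\<Sum>K\<in>p. increment \<delta> (U x) s (Inf K) * increment \<delta> (V x) (Inf K) (Sup K))"

lemma increment_product_square_integrable:
  assumes "0 \<le> a" "a \<le> b" "0 \<le> c" "c \<le> d" "0 < \<delta>"
  shows "square_integrable P (\<lambda>x. increment \<delta> (U x) a b * increment \<delta> (V x) c d)"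
    and "(\<integral>x. (increment \<delta> (U x) a b * increment \<delta> (V x) c d)\<^sup>2 \<partial>P)
      \<le> (25 * min (b - a) \<delta>) * (25 * min (d - c) \<delta>)"
proof -
  \<comment> \<open>The product rule speaks of measurable functionals of the two paths, so the
    increments are exchanged for their functionals and back.\<close>
  have eq: "increment_functional \<delta> a b (U x) = increment \<delta> (U x) a b"
    "increment_functional \<delta> c d (V x) = increment \<delta> (V x) c d" if "x \<in> space P" for x
    using that assms U.increment_eq_functional V.increment_eq_functional by auto
  have "square_integrable P (\<lambda>x. increment_functional \<delta> a b (U x))"
    using U.increment_square_integrable(3)[of a b \<delta>] assms
    by (simp add: eq cong: square_integrable_cong)
  moreover have "square_integrable P (\<lambda>x. increment_functional \<delta> c d (V x))"
    using V.increment_square_integrable(3)[of c d \<delta>] assms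
    by (simp add: eq cong: square_integrable_cong)
  ultimately have *: "square_integrable P (\<lambda>x. increment_functional \<delta> a b (U x) * increment_functional \<delta> c d (V x))"
    "(\<integral>x. (increment_functional \<delta> a b (U x) * increment_functional \<delta> c d (V x))\<^sup>2 \<partial>P)
      = (\<integral>x. (increment_functional \<delta> a b (U x))\<^sup>2 \<partial>P) * (\<integral>x. (increment_functional \<delta> c d (V x))\<^sup>2 \<partial>P)"
    using product_square_integrable[of "increment_functional \<delta> a b" "increment_functional \<delta> c d"]
    by auto
  show "square_integrable P (\<lambda>x. increment \<delta> (U x) a b * increment \<delta> (V x) c d)"
    using *(1) by (simp add: eq cong: square_integrable_cong)
  have "(\<integral>x. (increment \<delta> (U x) a b * increment \<delta> (V x) c d)\<^sup>2 \<partial>P)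
      = (\<integral>x. (increment \<delta> (U x) a b)\<^sup>2 \<partial>P) * (\<integral>x. (increment \<delta> (V x) c d)\<^sup>2 \<partial>P)"
    using *(2) by (simp add: eq cong: Bochner_Integration.integral_cong)
  also have "\<dots> \<le> (25 * min (b - a) \<delta>) * (25 * min (d - c) \<delta>)"
    using assms
    by (intro mult_mono U.increment_square_integrable(4) V.increment_square_integrable(4)) auto
  finally show "(\<integral>x. (increment \<delta> (U x) a b * increment \<delta> (V x) c d)\<^sup>2 \<partial>P)
      \<le> (25 * min (b - a) \<delta>) * (25 * min (d - c) \<delta>)" .
qed

lemma area_sum_square_integrable:
  assumes "0 \<le> s" "0 < \<delta>" "p division_of {s..t}"
  shows "square_integrable P (area_sum \<delta> s p)"
  unfolding area_sum_def
  using division_of_Icc_memberD[OF assms(3)] assms(1,2)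
  by (intro square_integrable_sum increment_product_square_integrable(1)) (auto intro: order_trans)

text \<open>At almost every time \<open>a\<close> the integrand is the increment from
  \<open>s\<close> to the left end point of the member containing \<open>a\<close>, with second
  moment at most \<open>25 * min (t - s) \<delta>\<close>; the step sum estimate contributes the
  factor \<open>6 * (t - s)\<close>.\<close>

lemma area_sum_second_moment:
  assumes st: "0 \<le> s" "s \<le> t" and \<delta>: "0 < \<delta>" and p: "p division_of {s..t}"
  shows "(\<integral>x. (area_sum \<delta> s p x)\<^sup>2 \<partial>P) \<le> 150 * (t - s) * min (t - s) \<delta>"
proof -
  note K = division_of_Icc_memberD[OF p]
  define \<zeta> where "\<zeta> K = increment_functional \<delta> s (Inf K)" for K
  have \<zeta>: "\<zeta> K (U x) = increment \<delta> (U x) s (Inf K)" if "K \<in> p" "x \<in> space P" for K x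
    using U.increment_eq_functional[OF that(2) K(2)[OF that(1)]] by (simp add: \<zeta>_def)
  have "(\<integral>x. (area_sum \<delta> s p x)\<^sup>2 \<partial>P)
      = (\<integral>x. (\<Sum>K\<in>p. \<zeta> K (U x) * increment \<delta> (V x) (Inf K) (Sup K))\<^sup>2 \<partial>P)"
    by (intro Bochner_Integration.integral_cong refl) (simp add: area_sum_def \<zeta>)
  also have "\<dots> \<le> 6 * (t - s) * (25 * min (t - s) \<delta>)"
  proof (rule integral_square_step_sum_le[OF \<delta> st(2)])
    show "\<zeta> K \<in> borel_measurable path_space" for K
      by (simp add: \<zeta>_def)
    show "square_integrable P (\<lambda>x. \<zeta> K (U x))" if "K \<in> p" for K
      using U.increment_square_integrable(3)[of s "Inf K" \<delta>] st \<delta> K[OF that]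
      by (simp add: \<zeta> that cong: square_integrable_cong)
    show "s \<le> Inf K \<and> Inf K \<le> Sup K \<and> Sup K \<le> t" if "K \<in> p" for K
      using K[OF that] by simp
    show "AE a in lborel_on s t.
        (\<integral>x. (\<Sum>K\<in>p. \<zeta> K (U x) * indicator {Inf K..Sup K} a)\<^sup>2 \<partial>P) \<le> 25 * min (t - s) \<delta>"
      using division_of_Icc_AE_sum_indicator[OF p]
    proof eventually_elim
      case (elim a)
      then obtain K where "K \<in> p" and
        sum: "\<And>F. (\<Sum>L\<in>p. F L * indicator {Inf L..Sup L} a) = (F K :: real)"
        by blast
      have "(\<integral>x. (\<Sum>K\<in>p. \<zeta> K (U x) * indicator {Inf K..Sup K} a)\<^sup>2 \<partial>P)
          = (\<integral>x. (increment \<delta> (U x) s (Inf K))\<^sup>2 \<partial>P)"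
        unfolding sum[of "\<lambda>L. \<zeta> L (U x)" for x] by (intro Bochner_Integration.integral_cong refl) (simp add: \<zeta> \<open>K \<in> p\<close>)
      also have "\<dots> \<le> 25 * min (Inf K - s) \<delta>"
        using st \<delta> K[OF \<open>K \<in> p\<close>] by (intro U.increment_square_integrable(4)) auto
      also have "\<dots> \<le> 25 * min (t - s) \<delta>"
        using K[OF \<open>K \<in> p\<close>] by (auto simp: min_def)
      finally show ?case .
    qed
  qed (use st \<delta> in auto)
  finally show ?thesis by (simp add: algebra_simps)
qed

text \<open>The difference is treated as one step sum over the disjoint union
  \<open>p <+> q\<close>, with negated weights on \<open>q\<close>; this takes the place of a common
  refinement. The estimate for step sums allows overlapping intervals.\<close>

lemma area_sum_Cauchy:
  assumes st: "0 \<le> s" "s \<le> t" and \<delta>: "0 < \<delta>" and "0 < \<eta>"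
    and p: "p \<in> fine_divisions s t \<eta>" and q: "q \<in> fine_divisions s t \<eta>"
  shows "(\<integral>x. (area_sum \<delta> s p x - area_sum \<delta> s q x)\<^sup>2 \<partial>P) \<le> 150 * (t - s) * \<eta>"
proof -
  have pd: "p division_of {s..t}" and qd: "q division_of {s..t}"
    using p q by (auto simp: fine_divisions_def)
  note K = division_of_Icc_memberD[OF pd] and L = division_of_Icc_memberD[OF qd]
  have "finite p" "finite q"
    using pd qd by (auto intro: division_of_finite)
  define set_of where "set_of = case_sum (\<lambda>K. K) (\<lambda>K :: real set. K)"
  define \<zeta> where "\<zeta> = case_sum (\<lambda>K. increment_functional \<delta> s (Inf K))
    (\<lambda>K f. - increment_functional \<delta> s (Inf K) f)"
  have ends: "s \<le> Inf (set_of n) \<and> Inf (set_of n) \<le> Sup (set_of n) \<and> Sup (set_of n) \<le> t"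
    if "n \<in> p <+> q" for n
    using that K L by (auto simp: set_of_def)
  have \<zeta>p: "increment_functional \<delta> s (Inf K) (U x) = increment \<delta> (U x) s (Inf K)"
    if "K \<in> p \<or> K \<in> q" "x \<in> space P" for K x
    using that K L by (intro U.increment_eq_functional[symmetric]) auto
  have "(\<integral>x. (area_sum \<delta> s p x - area_sum \<delta> s q x)\<^sup>2 \<partial>P)
      = (\<integral>x. (\<Sum>n\<in>p <+> q. \<zeta> n (U x) * increment \<delta> (V x) (Inf (set_of n)) (Sup (set_of n)))\<^sup>2 \<partial>P)"
    by (intro Bochner_Integration.integral_cong refl)
       (simp add: area_sum_def \<zeta>_def set_of_def sum.Plus \<open>finite p\<close> \<open>finite q\<close> \<zeta>p sum_negf)
  also have "\<dots> \<le> 6 * (t - s) * (25 * \<eta>)"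
  proof (rule integral_square_step_sum_le[OF \<delta> st(2)])
    show "\<zeta> n \<in> borel_measurable path_space" for n
      by (cases n) (auto simp: \<zeta>_def)
    show "square_integrable P (\<lambda>x. \<zeta> n (U x))" if "n \<in> p <+> q" for n
    proof -
      have si: "square_integrable P (\<lambda>x. increment_functional \<delta> s (Inf K) (U x))"
        if "K \<in> p \<or> K \<in> q" for K
      proof -
        have "s \<le> Inf K" using that K L by auto
        then show ?thesis
          using U.increment_square_integrable(3)[of s "Inf K" \<delta>] st \<delta> that
          by (simp add: \<zeta>p cong: square_integrable_cong)
      qed
      show ?thesis
        using that si square_integrable_cmult[OF si, of _ "-1"] by (auto simp: \<zeta>_def)
    qed
    show "AE a in lborel_on s t.
        (\<integral>x. (\<Sum>n\<in>p <+> q. \<zeta> n (U x) * indicator {Inf (set_of n)..Sup (set_of n)} a)\<^sup>2 \<partial>P) \<le> 25 * \<eta>"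
      using division_of_Icc_AE_sum_indicator[OF pd] division_of_Icc_AE_sum_indicator[OF qd]
    proof eventually_elim
      case (elim a)
      then obtain K' L' where K': "K' \<in> p" "a \<in> K'" and L': "L' \<in> q" "a \<in> L'"
        and sums: "(\<Sum>K\<in>p. F K * indicator {Inf K..Sup K} a) = F K'"
          "(\<Sum>K\<in>q. F K * indicator {Inf K..Sup K} a) = F L'" for F :: "real set \<Rightarrow> real"
        by metis
      have "(\<integral>x. (\<Sum>n\<in>p <+> q. \<zeta> n (U x) * indicator {Inf (set_of n)..Sup (set_of n)} a)\<^sup>2 \<partial>P)
          = (\<integral>x. (increment \<delta> (U x) (Inf L') (Inf K'))\<^sup>2 \<partial>P)"
      proof (intro Bochner_Integration.integral_cong refl)
        fix x assume "x \<in> space P"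
        have "(\<Sum>n\<in>p <+> q. \<zeta> n (U x) * indicator {Inf (set_of n)..Sup (set_of n)} a)
            = (\<Sum>K\<in>p. increment_functional \<delta> s (Inf K) (U x) * indicator {Inf K..Sup K} a)
              - (\<Sum>K\<in>q. increment_functional \<delta> s (Inf K) (U x) * indicator {Inf K..Sup K} a)"
          unfolding sum.Plus[OF \<open>finite p\<close> \<open>finite q\<close>]
          by (simp only: \<zeta>_def set_of_def comp_def sum.case mult_minus_left sum_negf diff_conv_add_uminus)
        also have "\<dots> = increment \<delta> (U x) s (Inf K') - increment \<delta> (U x) s (Inf L')"
          using K' L' \<open>x \<in> space P\<close> by (simp add: sums \<zeta>p)
        finally show "(\<Sum>n\<in>p <+> q. \<zeta> n (U x) * indicator {Inf (set_of n)..Sup (set_of n)} a)\<^sup>2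
            = (increment \<delta> (U x) (Inf L') (Inf K'))\<^sup>2"
          by (simp add: increment_def)
      qed
      also have "\<dots> \<le> 25 * min \<bar>Inf K' - Inf L'\<bar> \<delta>"
        using st \<delta> K(2)[OF K'(1)] L(2)[OF L'(1)] by (intro U.increment_second_moment) auto
      also have "\<dots> \<le> 25 * \<eta>"
      proof -
        \<comment> \<open>Both members contain \<open>a\<close> and are shorter than
          \<open>\<eta>\<close>, so both left end points lie less than \<open>\<eta>\<close> below
          \<open>a\<close>.\<close>
        have "Sup K' - Inf K' < \<eta>" "Sup L' - Inf L' < \<eta>"
          using p q K'(1) L'(1) by (auto simp: fine_divisions_def)
        moreover have "Inf K' \<le> a" "a \<le> Sup K'" "Inf L' \<le> a" "a \<le> Sup L'"
          using K(1)[OF K'(1)] L(1)[OF L'(1)] K'(2) L'(2) by (metis atLeastAtMost_iff)+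
        ultimately show ?thesis by (auto simp: min_def)
      qed
      finally show ?case .
    qed
  qed (use \<open>0 < \<eta>\<close> ends in auto)
  finally show ?thesis by (simp add: algebra_simps)
qed

lemma area_sum_limit_exists:
  assumes "0 \<le> s" "s \<le> t" "0 < \<delta>"
  shows "\<exists>A. square_integrable P A \<and>
    (\<forall>\<epsilon>>0. \<exists>\<eta>>0. \<forall>p\<in>fine_divisions s t \<eta>. L2_norm P (\<lambda>x. area_sum \<delta> s p x - A x) < \<epsilon>)"
proof (rule L2_limit_exists[OF U.finite_measure_axioms, where c="150 * (t - s)"])
  show "fine_divisions s t \<eta> \<noteq> {}" if "0 < \<eta>" for \<eta>
    using fine_divisions_nonempty[OF that] .
  show "fine_divisions s t \<eta> \<subseteq> fine_divisions s t \<eta>'" if "\<eta> \<le> \<eta>'" for \<eta> \<eta>'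
    using that by (fastforce simp: fine_divisions_def)
  show "square_integrable P (area_sum \<delta> s p)" if "p \<in> fine_divisions s t \<eta>" for \<eta> p
    using that assms by (intro area_sum_square_integrable) (auto simp: fine_divisions_def)
qed (use assms area_sum_Cauchy in blast)

lemma area_sum_limit_second_moment:
  assumes st: "0 \<le> s" "s \<le> t" and \<delta>: "0 < \<delta>" and A: "square_integrable P A"
    and lim: "\<And>\<epsilon>. 0 < \<epsilon> \<Longrightarrow> \<exists>\<eta>>0. \<forall>p\<in>fine_divisions s t \<eta>. L2_norm P (\<lambda>x. area_sum \<delta> s p x - A x) < \<epsilon>"
  shows "(\<integral>x. (A x)\<^sup>2 \<partial>P) \<le> 300 * (t - s) * min (t - s) \<delta>"
proof (rule field_le_epsilon)
  fix e :: real assume "0 < e"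
  \<comment> \<open>With this tolerance the error has second moment at most \<open>e / 2\<close>,
    which the factor 2 from splitting the square turns into \<open>e\<close>.\<close>
  then have "0 < sqrt (e / 2)" by simp
  from lim[OF this] obtain \<eta> where "0 < \<eta>"
    and \<eta>: "\<And>p. p \<in> fine_divisions s t \<eta> \<Longrightarrow> L2_norm P (\<lambda>x. area_sum \<delta> s p x - A x) < sqrt (e / 2)"
    by blast
  obtain p where p: "p \<in> fine_divisions s t \<eta>"
    using fine_divisions_nonempty[OF \<open>0 < \<eta>\<close>] by blast
  then have pd: "p division_of {s..t}" by (simp add: fine_divisions_def)
  note si = area_sum_square_integrable[OF st(1) \<delta> pd]
  have "(\<integral>x. (A x)\<^sup>2 \<partial>P) = (\<integral>x. (area_sum \<delta> s p x + (-1) * (area_sum \<delta> s p x - A x))\<^sup>2 \<partial>P)"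
    by simp
  also have "\<dots> \<le> 2 * (\<integral>x. (area_sum \<delta> s p x)\<^sup>2 \<partial>P) + 2 * (\<integral>x. ((-1) * (area_sum \<delta> s p x - A x))\<^sup>2 \<partial>P)"
    by (intro integral_square_add_le si square_integrable_cmult square_integrable_diff A)
  also have "(\<integral>x. ((-1) * (area_sum \<delta> s p x - A x))\<^sup>2 \<partial>P) = (\<integral>x. (area_sum \<delta> s p x - A x)\<^sup>2 \<partial>P)"
    by (simp add: power2_commute)
  also have "\<dots> \<le> e / 2"
    using \<eta>[OF p] by (simp add: L2_norm_def)
  also have "(\<integral>x. (area_sum \<delta> s p x)\<^sup>2 \<partial>P) \<le> 150 * (t - s) * min (t - s) \<delta>"
    by (rule area_sum_second_moment[OF st \<delta> pd])
  finally show "(\<integral>x. (A x)\<^sup>2 \<partial>P) \<le> 300 * (t - s) * min (t - s) \<delta> + e"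
    by (simp add: algebra_simps)
qed

end

subsection \<open>The area of the smoothing error\<close>

lemma brownian_moments_wiener_measure:
  assumes "wiener_measure m P" and "i \<in> {1..m}"
  shows "brownian_moments P (\<lambda>w t. w t i)"
proof (rule brownian_moments_if_two_sided_brownian_motion)
  show "prob_space P" "two_sided_brownian_motion P (\<lambda>w t. w t i)"
    using assms by (auto simp: wiener_measure_def)
  \<comment> \<open>Independence of the family includes measurability of each coordinate path as a
    map into \<open>path_space\<close>.\<close>
  have "prob_space.indep_vars P (\<lambda>_. path_space) (\<lambda>i w t. w t i) {1..m}"
    using assms by (simp add: wiener_measure_def)
  then show "(\<lambda>w t. w t i) \<in> measurable P path_space"
    using assms by (simp add: prob_space.indep_vars_def[OF \<open>prob_space P\<close>])
qed

text \<open>The disjoint index blocks \<open>{i}\<close> and \<open>{j}\<close> of the independent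
  family are independent, and projecting each block to its only coordinate gives the pair of
  paths.\<close>

lemma independent_brownian_moments_wiener_measure:
  assumes P: "wiener_measure m P" and ij: "i \<in> {1..m}" "j \<in> {1..m}" "i \<noteq> j"
  shows "independent_brownian_moments P (\<lambda>w t. w t i) (\<lambda>w t. w t j)"
proof -
  interpret U: brownian_moments P "\<lambda>w t. w t i"
    by (rule brownian_moments_wiener_measure[OF P ij(1)])
  interpret V: brownian_moments P "\<lambda>w t. w t j"
    by (rule brownian_moments_wiener_measure[OF P ij(2)])
  have "U.indep_vars (\<lambda>_. path_space) (\<lambda>i w t. w t i) {1..m}"
    using P by (simp add: wiener_measure_def)
  from U.indep_var_restrict[OF this, of "{i}" "{j}"] ij
  have "U.indep_var (PiM {i} (\<lambda>_. path_space)) (\<lambda>w. restrict (\<lambda>i t. w t i) {i})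
      (PiM {j} (\<lambda>_. path_space)) (\<lambda>w. restrict (\<lambda>i t. w t i) {j})"
    by simp
  from U.indep_var_compose[OF this, of "\<lambda>f. f i" path_space "\<lambda>f. f j" path_space]
  have "U.indep_var path_space (\<lambda>w t. w t i) path_space (\<lambda>w t. w t j)"
    by (simp add: comp_def measurable_component_singleton)
  then show ?thesis
    by unfold_locales
qed

lemma smoothing_error_increment:
  "smoothing_error \<delta> w b i - smoothing_error \<delta> w a i = increment \<delta> (\<lambda>t. w t i) a b"
  by (simp add: smoothing_error_def smoothed_def increment_def smoothing_remainder_def)

text \<open>The bound is stated for every limit \<open>A\<close>, because \<open>L2_integral\<close>
  is an arbitrary choice among the versions.\<close>

lemma has_L2_integral_smoothing_error:
  assumes P: "wiener_measure m P" and ij: "i \<in> {1..m}" "j \<in> {1..m}" "i \<noteq> j"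
    and st: "0 \<le> s" "s \<le> t" and \<delta>: "0 < \<delta>"
  shows "\<exists>A. has_L2_integral P (smoothing_error \<delta>) i j s t A"
    and "has_L2_integral P (smoothing_error \<delta>) i j s t A \<Longrightarrow>
      square_integrable P A \<and> (\<integral>x. (A x)\<^sup>2 \<partial>P) \<le> 300 * (t - s) * min (t - s) \<delta>"
proof -
  interpret independent_brownian_moments P "\<lambda>w t. w t i" "\<lambda>w t. w t j"
    by (rule independent_brownian_moments_wiener_measure[OF P ij])
  have sum: "riemann_sum (smoothing_error \<delta>) i j s p = area_sum \<delta> s p" for p
    by (simp add: fun_eq_iff riemann_sum_def area_sum_def smoothing_error_increment)
  have iff: "has_L2_integral P (smoothing_error \<delta>) i j s t A \<longleftrightarrow> square_integrable P A \<and>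
    (\<forall>\<epsilon>>0. \<exists>\<eta>>0. \<forall>p\<in>fine_divisions s t \<eta>. L2_norm P (\<lambda>x. area_sum \<delta> s p x - A x) < \<epsilon>)" for A
    using area_sum_square_integrable[OF st(1) \<delta>, of _ t]
    by (simp add: has_L2_integral_def sum fine_divisions_def)
  show "\<exists>A. has_L2_integral P (smoothing_error \<delta>) i j s t A"
    using area_sum_limit_exists[OF st \<delta>] by (simp add: iff)
  show "square_integrable P A \<and> (\<integral>x. (A x)\<^sup>2 \<partial>P) \<le> 300 * (t - s) * min (t - s) \<delta>"
    if "has_L2_integral P (smoothing_error \<delta>) i j s t A"
    using that area_sum_limit_second_moment[OF st \<delta>, of A] unfolding iff by blast
qed

lemma L2_integral_smoothing_error:
  assumes "wiener_measure m P" "i \<in> {1..m}" "j \<in> {1..m}" "i \<noteq> j"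
    and "0 \<le> s" "s \<le> t" "0 < \<delta>"
  shows "square_integrable P (L2_integral P (smoothing_error \<delta>) i j s t)"
    and "(\<integral>x. (L2_integral P (smoothing_error \<delta>) i j s t x)\<^sup>2 \<partial>P) \<le> 300 * (t - s) * min (t - s) \<delta>"
  using has_L2_integral_smoothing_error(2)[OF assms, OF someI_ex[OF has_L2_integral_smoothing_error(1)[OF assms]]]
  by (simp_all add: L2_integral_def)

text \<open>The constant is set by the case \<open>j < i\<close>, where integration by parts gives
  \<open>2 * 300 + 2 * 25 * 25\<close>. Terms with the square of \<open>min (t - s) \<delta>\<close>
  are absorbed since this minimum is at most \<open>t - s\<close>.\<close>

lemma area_smoothing_error_second_moment:
  assumes P: "wiener_measure m P" and ij: "i \<in> {1..m}" "j \<in> {1..m}"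
    and st: "0 \<le> s" "s \<le> t" and \<delta>: "0 < \<delta>"
  shows "square_integrable P (area P (smoothing_error \<delta>) i j s t)"
    and "(\<integral>x. (area P (smoothing_error \<delta>) i j s t x)\<^sup>2 \<partial>P) \<le> 1850 * ((t - s) * min (t - s) \<delta>)"
proof -
  define c where "c = min (t - s) \<delta>"
  have c: "0 \<le> c" "c \<le> t - s" using st \<delta> by (auto simp: c_def)
  then have cc: "c * c \<le> (t - s) * c" "0 \<le> (t - s) * c" by (auto intro: mult_right_mono)
  consider "i < j" | "i = j" | "j < i" by linarith
  then have "square_integrable P (area P (smoothing_error \<delta>) i j s t) \<and>
    (\<integral>x. (area P (smoothing_error \<delta>) i j s t x)\<^sup>2 \<partial>P) \<le> 1850 * ((t - s) * c)"
  proof cases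
    case 1
    have "area P (smoothing_error \<delta>) i j s t = L2_integral P (smoothing_error \<delta>) i j s t"
      using 1 by (simp add: area_def[abs_def])
    moreover have "300 * (t - s) * c \<le> 1850 * ((t - s) * c)"
      using cc(2) unfolding mult.assoc by linarith
    ultimately show ?thesis
      using L2_integral_smoothing_error[OF P ij _ st \<delta>] 1 unfolding c_def by force
  next
    case 2
    interpret brownian_moments P "\<lambda>w t. w t i"
      by (rule brownian_moments_wiener_measure[OF P ij(1)])
    have area: "area P (smoothing_error \<delta>) i j s t = (\<lambda>w. (1 / 2) * (increment \<delta> (\<lambda>t. w t i) s t)\<^sup>2)"
      using 2 by (simp add: area_def[abs_def] smoothing_error_increment)
    note si = increment_square_integrable(1,2)[OF st \<delta>]
    have "(\<integral>w. ((1 / 2) * (increment \<delta> (\<lambda>t. w t i) s t)\<^sup>2)\<^sup>2 \<partial>P)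
        = (1 / 4) * (\<integral>w. ((increment \<delta> (\<lambda>t. w t i) s t)\<^sup>2)\<^sup>2 \<partial>P)"
      unfolding power_mult_distrib by (simp add: power2_eq_square)
    also have "\<dots> \<le> (1 / 4) * (48 * (c * c))"
      using si(2) by (simp add: c_def power2_eq_square)
    also have "\<dots> \<le> 1850 * ((t - s) * c)"
      using cc by (simp add: algebra_simps)
    finally show ?thesis
      unfolding area using square_integrable_cmult[OF si(1)] by blast
  next
    case 3
    interpret independent_brownian_moments P "\<lambda>w t. w t j" "\<lambda>w t. w t i"
      using 3 by (intro independent_brownian_moments_wiener_measure[OF P]) (use ij in auto)
    define A where "A = L2_integral P (smoothing_error \<delta>) j i s t"
    define Q where "Q = (\<lambda>w. increment \<delta> (\<lambda>t. w t j) s t * increment \<delta> (\<lambda>t. w t i) s t)"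
    have area: "area P (smoothing_error \<delta>) i j s t = (\<lambda>w. (-1) * A w + Q w)"
      using 3 by (simp add: area_def[abs_def] smoothing_error_increment A_def Q_def)
    have A: "square_integrable P A" "(\<integral>x. (A x)\<^sup>2 \<partial>P) \<le> 300 * (t - s) * c"
      using L2_integral_smoothing_error[OF P ij(2,1) _ st \<delta>] 3 by (simp_all add: A_def c_def)
    have Q: "square_integrable P Q" "(\<integral>x. (Q x)\<^sup>2 \<partial>P) \<le> (25 * c) * (25 * c)"
      using increment_product_square_integrable[OF st st \<delta>] by (simp_all add: Q_def c_def)
    have A': "square_integrable P (\<lambda>w. (-1) * A w)"
      by (rule square_integrable_cmult[OF A(1)])
    have "(\<integral>w. ((-1) * A w + Q w)\<^sup>2 \<partial>P) \<le> 2 * (\<integral>w. ((-1) * A w)\<^sup>2 \<partial>P) + 2 * (\<integral>w. (Q w)\<^sup>2 \<partial>P)"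
      by (rule integral_square_add_le[OF A' Q(1)])
    also have "\<dots> \<le> 2 * (300 * (t - s) * c) + 2 * ((25 * c) * (25 * c))"
      using A(2) Q(2) by simp
    also have "\<dots> \<le> 1850 * ((t - s) * c)"
      using cc by (simp add: algebra_simps)
    finally show ?thesis
      unfolding area using square_integrable_add[OF A' Q(1)] by blast
  qed
  then show "square_integrable P (area P (smoothing_error \<delta>) i j s t)"
    and "(\<integral>x. (area P (smoothing_error \<delta>) i j s t x)\<^sup>2 \<partial>P) \<le> 1850 * ((t - s) * min (t - s) \<delta>)"
    by (auto simp: c_def)
qed

section \<open>Interpolation and conclusion\<close>

text \<open>With \<open>e = 2 * (1 - 1 / \<rho>)\<close> in the unit interval, the right side is
  \<open>\<delta> powr e * h powr (2 - e)\<close>. If \<open>h \<le> \<delta>\<close>, the factor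
  \<open>h powr e\<close> of \<open>h * h\<close> is enlarged; otherwise the factor
  \<open>\<delta> powr (1 - e)\<close> of \<open>h * \<delta>\<close> is.\<close>

lemma mult_min_le_powr:
  fixes h \<delta> \<rho> :: real
  assumes "1 \<le> \<rho>" "\<rho> \<le> 2" "0 \<le> h" "0 < \<delta>"
  shows "h * min h \<delta> \<le> \<delta> powr (2 * (1 - 1 / \<rho>)) * h powr (2 / \<rho>)"
proof (cases "h = 0")
  case True
  then show ?thesis by simp
next
  case False
  then have h: "0 < h" using assms by simp
  define e where "e = 2 * (1 - 1 / \<rho>)"
  have e: "0 \<le> e" "e \<le> 1" "2 / \<rho> = 2 - e"
    using assms by (auto simp: e_def field_simps)
  show ?thesis
  proof (cases "h \<le> \<delta>")
    case True
    have "h * h = h powr e * h powr (2 - e)"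
      unfolding powr_add[symmetric] using h by (simp add: powr_numeral power2_eq_square)
    also have "\<dots> \<le> \<delta> powr e * h powr (2 - e)"
      using h True e by (intro mult_right_mono powr_mono2) auto
    finally show ?thesis unfolding e_def[symmetric] e(3) using True by simp
  next
    case False
    have "h * \<delta> = h * (\<delta> powr e * \<delta> powr (1 - e))"
      unfolding powr_add[symmetric] using assms by simp
    also have "\<dots> \<le> h * (\<delta> powr e * h powr (1 - e))"
      using False h e assms by (intro mult_left_mono powr_mono2) auto
    also have "\<dots> = \<delta> powr e * (h powr 1 * h powr (1 - e))"
      using h by simp
    also have "\<dots> = \<delta> powr e * h powr (2 - e)"
      unfolding powr_add[symmetric] by simp
    finally show ?thesis unfolding e_def[symmetric] e(3) using False by simp
  qed
qed

theorem corollary11: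
  fixes \<rho> :: real
  assumes "1 \<le> \<rho>" and "\<rho> < 2"
  shows "\<exists>C::real. \<forall>(m::nat) (P::path measure) (\<delta>::real) (s::real) (t::real).
    wiener_measure m P \<longrightarrow> 0 < \<delta> \<longrightarrow> \<delta> \<le> 1 \<longrightarrow> 0 \<le> s \<longrightarrow> s \<le> t \<longrightarrow>
      area_well_defined P m (smoothing_error \<delta>) s t \<and>
      (\<forall>i\<in>{1..m}. \<forall>j\<in>{1..m}.
         square_integrable P (area P (smoothing_error \<delta>) i j s t) \<and>
         (L2_norm P (area P (smoothing_error \<delta>) i j s t))\<^sup>2
           \<le> C * \<delta> powr (2 * (1 - 1 / \<rho>))
               * (((2 powr (1 + \<rho>) + 1) / 3 powr (1 - \<rho>)) powr (1 / \<rho>))\<^sup>2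
               * \<bar>t - s\<bar> powr (2 / \<rho>))"
proof -
  define M where "M = ((2 powr (1 + \<rho>) + 1) / 3 powr (1 - \<rho>)) powr (1 / \<rho>)"
  have "0 < (2 powr (1 + \<rho>) + 1) / 3 powr (1 - \<rho>)"
    by (intro divide_pos_pos add_pos_pos) auto
  then have M: "0 < M" unfolding M_def by (metis less_irrefl powr_gt_zero)
  \<comment> \<open>The witness for \<open>C\<close> is \<open>1850 / M^2\<close>: it depends on
    \<open>\<rho>\<close> alone, and its denominator cancels the factor \<open>M^2\<close> of the
    claim.\<close>
  have "area_well_defined P m (smoothing_error \<delta>) s t \<and>
      (\<forall>i\<in>{1..m}. \<forall>j\<in>{1..m}.
         square_integrable P (area P (smoothing_error \<delta>) i j s t) \<and>
         (L2_norm P (area P (smoothing_error \<delta>) i j s t))\<^sup>2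
           \<le> 1850 / M\<^sup>2 * \<delta> powr (2 * (1 - 1 / \<rho>)) * M\<^sup>2 * \<bar>t - s\<bar> powr (2 / \<rho>))"
    if P: "wiener_measure m P" and \<delta>: "0 < \<delta>" and st: "0 \<le> s" "s \<le> t"
    for m and P :: "path measure" and \<delta> s t
  proof (intro conjI ballI)
    show "area_well_defined P m (smoothing_error \<delta>) s t"
      using has_L2_integral_smoothing_error(1)[OF P _ _ _ st \<delta>]
      by (auto simp: area_well_defined_def)
    fix i j assume ij: "i \<in> {1..m}" "j \<in> {1..m}"
    note * = area_smoothing_error_second_moment[OF P ij st \<delta>]
    show "square_integrable P (area P (smoothing_error \<delta>) i j s t)"
      by (rule *(1))
    have "(L2_norm P (area P (smoothing_error \<delta>) i j s t))\<^sup>2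
        = (\<integral>x. (area P (smoothing_error \<delta>) i j s t x)\<^sup>2 \<partial>P)"
      by (simp add: L2_norm_def)
    also have "\<dots> \<le> 1850 * ((t - s) * min (t - s) \<delta>)"
      by (rule *(2))
    also have "\<dots> \<le> 1850 * (\<delta> powr (2 * (1 - 1 / \<rho>)) * (t - s) powr (2 / \<rho>))"
      using assms st \<delta> by (intro mult_left_mono mult_min_le_powr) auto
    also have "\<dots> = 1850 / M\<^sup>2 * \<delta> powr (2 * (1 - 1 / \<rho>)) * M\<^sup>2 * \<bar>t - s\<bar> powr (2 / \<rho>)"
      using M st by simp
    finally show "(L2_norm P (area P (smoothing_error \<delta>) i j s t))\<^sup>2
        \<le> 1850 / M\<^sup>2 * \<delta> powr (2 * (1 - 1 / \<rho>)) * M\<^sup>2 * \<bar>t - s\<bar> powr (2 / \<rho>)" .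
  qed
  then show ?thesis
    unfolding M_def by blast
qed

end
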